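(* Let the thin-tail prior (with parameters $r,\beta>0$) be used. Suppose there exist $g_0\in\Theta_I$ with $g_{q_n}^*$ being its sieve approximation in $\mathcal{H}_n$, and a sequence $B_n^*\to\infty$ such that $$\max\bigl\{G(g_{q_n}^* ),\ \lambda(B_n^* ),\ \gamma(B_n^* )e^{-n\lambda(B_n^* )/q_n}\bigr\}=o\bigl(B_n^{*r}/n\bigr).$$ In addition, suppose the positive sequence $\delta_n=O(1)$ is such that $$\max\bigl\{G(g_{q_n}^* ),\ \lambda(B_n^* ),\ \gamma(B_n^* )e^{-n\lambda(B_n^* )/q_n}\bigr\}=o(\delta_n).$$ Then under Assumptions A1--A4 (listed in the context), $$P\bigl(G(g_b)<\delta_n\mid X^n\bigr)\to 1\quad\text{in probability}.$$
   Context: Model: $(Z,W)$ is a random vector, $W$ takes values in $[0,1]^d$ ($d$ fixed). $(\mathcal H,\|\cdot\|_s)$ is an infinite-dimensional Banach space of functions of a covariate $X$ (a subvector of the observables). $\rho(Z,g)$ is a known real-valued residual function, $g\in\mathcal H$. The true $g_0$ satisfies $E[\rho(Z,g_0)\mid W]=0$; all expectations are under the true law. $G(g)=E_W\{[E(\rho(Z,g)\mid W)]^2\}$. The identified region $\Theta_I=\{g\in\mathcal H: E(\rho(Z,g)\mid W=w)=0\text{ for almost all }w\}=\{g\in\mathcal H:G(g)=0\}$ is nonempty, not necessarily a singleton. Sieve: $\phi_1,\phi_2,\ldots\in\mathcal H$, integers $q_n\to\infty$, $\mathcal H_n=\mathrm{span}\{\phi_1,\ldots,\phi_{q_n}\}$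 (growing dense in $\mathcal H$), $g_b=\sum_{i=1}^{q_n}b_i\phi_i$ for $b\in\mathbb R^{q_n}$; for a sequence $B_n\to\infty$, $\mathcal F_n=\mathcal F_n(B_n)=\{\sum_{i=1}^{q_n}b_i\phi_i:\max_{i\le q_n}|b_i|\le B_n\}$. Likelihood and posterior: data $X^n=\{(Z_i,W_i)\}_{i=1}^n$. For integers $k_n\to\infty$, $[0,1]^d$ is partitioned into the $k_n^d$ cubes $R^n_j$ of the form $\prod_{l=1}^d[\frac{i_l-1}{k_n},\frac{i_l}{k_n}]$, $i_l\in\{1,\ldots,k_n\}$. $\bar m_{nj}(g)=\frac1n\sum_{i=1}^n\rho(Z_i,g)I_{(W_i\in R^n_j)}$, $\hat v_j=\frac1n\sum_{i=1}^nI_{(W_i\in R_j^n)}$, $\bar G(g)=\sum_{j=1}^{k_n^d}\bar m_{nj}(g)^2\hat v_j^{-1}$ (terms with $\hat v_j=0$ are read as $0$). The quasi-posterior is $P(g_b\mid X^n)\propto\pi(b)\exp(-\frac n2\bar G(g_b))$. Thin-tail prior: for fixed $\beta>0$, $r>0$, the spherically symmetric density on $\mathbb R^{q_n}$ with $\pi(\|b\|^r>u^r)=e^{-\beta^ru^r}$, i.e. $\pi(b)=r\|b\|^{r-q_n}\beta^re^{-\beta^r\|b\|^r}/S_{q_n}$, where $\|b\|$ is the Euclidean norm and $S_{q_n}$ is the area of the $(q_n-1)$-dimensional unit sphere. Assumptions: A1: the data $(Z_i,W_i)$ are i.i.d. A2: there is a positive sequence $\lambda_n=\lambda(B_n)\to0$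 with $\sup_{g\in\mathcal F_n(B_n)}|\bar G(g)-G(g)|=O_p(\lambda(B_n))$ (here used with $B_n=B_n^*$). A3: (i) $\phi_1,\ldots,\phi_{q_n}$ is an orthonormal basis of $\mathcal H_n$, $E(\phi_i(X)\phi_j(X))=\delta_{ij}$ (Kronecker delta); (ii) there exist $g_0\in\Theta_I$ and $g_{q_n}^*=\sum_{i=1}^{q_n}b_i^*\phi_i\in\mathcal H_n$ (the sieve approximation of $g_0$) with $\|g_{q_n}^*-g_0\|_s=o(1)$ as $q_n\to\infty$. A4: there is $C>0$ such that $E|\rho(Z,g_1)-\rho(Z,g_2)|\le C\,E|g_1(X)-g_2(X)|$ for all $g_1,g_2\in\mathcal H$. Also $\gamma(B_n)=\sup_{g\in\mathcal F_n(B_n),\,w\in[0,1]^d}|E(\rho(Z,g)\mid W=w)|+1$.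
   Formalization: Adds that every g in H is square integrable in X with (E g(X)^2)^{1/2} ≤ K‖g‖_s for some constant K; without a link between ‖·‖_s and L²(X) the claim fails (e.g. H = L¹, g_0(X) = X^{-0.9}, large r). *)

theory Defs
  imports "HOL-Probability.Probability" "HOL-Library.Landau_Symbols"
begin

text \<open>
  An observation is a pair \<open>p = (z, w)\<close> of type \<open>'z \<times> (real ^ 'd)\<close>, and \<open>P\<close> is its true law, so that
  \<open>Z\<close> is \<^term>\<open>fst\<close> and \<open>W\<close> is \<^term>\<open>snd\<close>.  Samples are sequences \<open>s\<close> of observations indexed from
  \<open>0\<close>; the sample of size \<open>n\<close> consists of \<open>s i\<close> for \<open>i < n\<close>.  Likewise the sieve basis functions
  are indexed from \<open>0\<close>, and the coefficient space \<open>\<real>\<^sup>q\<close> is the product space over \<open>{..<q}\<close>.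
\<close>

definition unit_cube :: "(real ^ 'd) set" where
  "unit_cube = {w. \<forall>l. 0 \<le> w $ l \<and> w $ l \<le> 1}"

text \<open>
  \<open>'h\<close> is the Banach space of functions, carrying its norm.  Its elements act as functions of the
  covariate \<open>X\<close> through \<open>val\<close>; \<open>X\<close> is a function \<open>cov\<close> of the observation.
  Linearity is required only almost surely, so that spaces of equivalence classes (\<open>L\<^sup>2\<close>, Sobolev
  spaces) are covered, with \<open>val\<close> choosing representatives.  The last clause says that the
  space embeds continuously into \<open>L\<^sup>2\<close> of the law of \<open>X\<close>.
\<close>

definition function_space ::
  "('z::euclidean_space \<times> (real ^ 'd)) measure \<Rightarrow> ('z \<times> (real ^ 'd) \<Rightarrow> 'x::euclidean_space) \<Rightarrow>
   ('h::banach \<Rightarrow> 'x \<Rightarrow> real) \<Rightarrow> bool" where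
  "function_space P cov val \<longleftrightarrow>
     \<not> (\<exists>S. finite S \<and> span S = (UNIV :: 'h set)) \<and>
     (\<forall>g. val g \<in> borel_measurable borel) \<and>
     (\<forall>a g h. AE p in P. val (a *\<^sub>R g + h) (cov p) = a * val g (cov p) + val h (cov p)) \<and>
     (\<forall>g. integrable P (\<lambda>p. (val g (cov p))\<^sup>2)) \<and>
     (\<exists>K. \<forall>g. sqrt (\<integral>p. (val g (cov p))\<^sup>2 \<partial>P) \<le> K * norm g)"

text \<open>\<open>h\<close> is a version of the regression function \<open>w \<mapsto> E(f(Z) | W = w)\<close>.\<close>

definition cond_mean_version ::
  "('z::euclidean_space \<times> (real ^ 'd)) measure \<Rightarrow> ('z \<Rightarrow> real) \<Rightarrow> (real ^ 'd \<Rightarrow> real) \<Rightarrow> bool" where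
  "cond_mean_version P f h \<longleftrightarrow>
     h \<in> borel_measurable borel \<and>
     (AE p in P. h (snd p) =
        real_cond_exp P (vimage_algebra (space P) snd borel) (\<lambda>p. f (fst p)) p)"

text \<open>
  Below, \<open>m g w\<close> stands for \<open>E(\<rho>(Z,g) | W = w)\<close>.  The criterion is extended-real valued: it is
  \<open>\<infinity>\<close> if the conditional mean is not square integrable.
\<close>

definition crit ::
  "('z::euclidean_space \<times> (real ^ 'd)) measure \<Rightarrow> ('h \<Rightarrow> real ^ 'd \<Rightarrow> real) \<Rightarrow> 'h \<Rightarrow> ereal" where
  "crit P m g = enn2ereal (\<integral>\<^sup>+ p. ennreal ((m g (snd p))\<^sup>2) \<partial>P)"

definition identified_region ::
  "('z::euclidean_space \<times> (real ^ 'd)) measure \<Rightarrow> ('h \<Rightarrow> real ^ 'd \<Rightarrow> real) \<Rightarrow> 'h set" where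
  "identified_region P m = {g. AE p in P. m g (snd p) = 0}"

definition sieve :: "(nat \<Rightarrow> 'h::real_vector) \<Rightarrow> nat \<Rightarrow> (nat \<Rightarrow> real) \<Rightarrow> 'h" where
  "sieve \<phi> q b = (\<Sum>i<q. b i *\<^sub>R \<phi> i)"

definition sieve_box :: "(nat \<Rightarrow> 'h::real_vector) \<Rightarrow> nat \<Rightarrow> real \<Rightarrow> 'h set" where
  "sieve_box \<phi> q B = {sieve \<phi> q b | b. \<forall>i<q. \<bar>b i\<bar> \<le> B}"

definition gamma_bound ::
  "('h::real_vector \<Rightarrow> real ^ 'd \<Rightarrow> real) \<Rightarrow> (nat \<Rightarrow> 'h) \<Rightarrow> nat \<Rightarrow> real \<Rightarrow> ereal" where
  "gamma_bound m \<phi> q B = (SUP g\<in>sieve_box \<phi> q B. SUP w\<in>unit_cube. ereal \<bar>m g w\<bar>) + 1"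

text \<open>The cells are indexed by the multi-indices \<open>j = (i\<^sub>l)\<^sub>l\<close> with all \<open>i\<^sub>l\<close> in \<open>{1..k}\<close>.\<close>

definition cell :: "nat \<Rightarrow> ('d \<Rightarrow> nat) \<Rightarrow> (real ^ 'd) set" where
  "cell k j = {w. \<forall>l. (real (j l) - 1) / real k \<le> w $ l \<and> w $ l \<le> real (j l) / real k}"

definition cell_moment ::
  "('z \<Rightarrow> 'h \<Rightarrow> real) \<Rightarrow> nat \<Rightarrow> nat \<Rightarrow> (nat \<Rightarrow> 'z \<times> (real ^ 'd)) \<Rightarrow> 'h \<Rightarrow> ('d \<Rightarrow> nat) \<Rightarrow> real" where
  "cell_moment \<rho> k n s g j =
     (1 / real n) * (\<Sum>i<n. \<rho> (fst (s i)) g * indicator (cell k j) (snd (s i)))"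

definition cell_freq :: "nat \<Rightarrow> nat \<Rightarrow> (nat \<Rightarrow> 'z \<times> (real ^ 'd)) \<Rightarrow> ('d \<Rightarrow> nat) \<Rightarrow> real" where
  "cell_freq k n s j = (1 / real n) * (\<Sum>i<n. indicator (cell k j) (snd (s i)))"

text \<open>Cells without observations contribute \<open>0\<close> because \<open>x / 0 = 0\<close>.\<close>

definition emp_crit ::
  "('z \<Rightarrow> 'h \<Rightarrow> real) \<Rightarrow> nat \<Rightarrow> nat \<Rightarrow> (nat \<Rightarrow> 'z \<times> (real ^ 'd)) \<Rightarrow> 'h \<Rightarrow> real" where
  "emp_crit \<rho> k n s g =
     (\<Sum>j\<in>UNIV \<rightarrow>\<^sub>E {1..k}. (cell_moment \<rho> k n s g j)\<^sup>2 / cell_freq k n s j)"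

abbreviation coeff_space :: "nat \<Rightarrow> (nat \<Rightarrow> real) measure" where
  "coeff_space q \<equiv> Pi\<^sub>M {..<q} (\<lambda>_. lborel)"

text \<open>Surface area of the unit sphere of \<open>\<real>\<^sup>q\<close>.\<close>

definition sphere_area :: "nat \<Rightarrow> real" where
  "sphere_area q = 2 * pi powr (real q / 2) / Gamma (real q / 2)"

definition thin_tail_density :: "real \<Rightarrow> real \<Rightarrow> nat \<Rightarrow> (nat \<Rightarrow> real) \<Rightarrow> real" where
  "thin_tail_density r \<beta> q b =
     r * L2_set b {..<q} powr (r - real q) * \<beta> powr r
       * exp (- (\<beta> powr r * L2_set b {..<q} powr r)) / sphere_area q"

definition quasi_posterior ::
  "real \<Rightarrow> real \<Rightarrow> ('z \<Rightarrow> 'h::real_vector \<Rightarrow> real) \<Rightarrow> (nat \<Rightarrow> 'h) \<Rightarrow> nat \<Rightarrow> nat \<Rightarrow> nat \<Rightarrow>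
   (nat \<Rightarrow> 'z \<times> (real ^ 'd)) \<Rightarrow> (nat \<Rightarrow> real) set \<Rightarrow> real" where
  "quasi_posterior r \<beta> \<rho> \<phi> q k n s S =
     (let f = (\<lambda>b. thin_tail_density r \<beta> q b
                     * exp (- (real n / 2) * emp_crit \<rho> k n s (sieve \<phi> q b)))
      in (LINT b:S|coeff_space q. f b) / (LINT b|coeff_space q. f b))"

text \<open>
  Stochastic orders are taken in outer probability, since suprema over uncountable classes need
  not be measurable; for measurable variables these are the usual notions.
\<close>

definition bounded_in_prob ::
  "'a measure \<Rightarrow> (nat \<Rightarrow> 'a \<Rightarrow> ereal) \<Rightarrow> (nat \<Rightarrow> real) \<Rightarrow> bool" where
  "bounded_in_prob M Y a \<longleftrightarrow>
     (\<forall>\<epsilon>>0. \<exists>K::real. \<forall>\<^sub>F n in sequentially. \<exists>A\<in>sets M.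
        measure M A \<le> \<epsilon> \<and> {\<omega>\<in>space M. \<bar>Y n \<omega>\<bar> > ereal (K * a n)} \<subseteq> A)"

definition tendsto_in_prob :: "'a measure \<Rightarrow> (nat \<Rightarrow> 'a \<Rightarrow> real) \<Rightarrow> real \<Rightarrow> bool" where
  "tendsto_in_prob M Y c \<longleftrightarrow>
     (\<forall>\<epsilon>>0. \<forall>\<eta>>0. \<forall>\<^sub>F n in sequentially. \<exists>A\<in>sets M.
        measure M A \<le> \<eta> \<and> {\<omega>\<in>space M. \<bar>Y n \<omega> - c\<bar> > \<epsilon>} \<subseteq> A)"

text \<open>\<open>f = o(a)\<close> for an extended-real sequence \<open>f\<close>; in particular \<open>f\<close> is eventually finite.\<close>

definition ereal_smallo :: "(nat \<Rightarrow> ereal) \<Rightarrow> (nat \<Rightarrow> real) \<Rightarrow> bool" where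
  "ereal_smallo f a \<longleftrightarrow> (\<forall>c>0. \<forall>\<^sub>F n in sequentially. \<bar>f n\<bar> \<le> ereal (c * \<bar>a n\<bar>))"

end

theory Submission
  imports Defs
begin

text \<open>
  The theorem is proved by comparing two integrals against the prior.  On an event of probability
  close to 1 the empirical criterion is within \<open>K \<lambda>\<^sub>n\<close> of the true criterion on the whole sieve
  box, and everything below happens at a fixed sample in that event.
  
  The posterior mass of the set where the criterion is at least \<open>\<delta>\<^sub>n\<close> has a numerator of at most
  \<open>exp (- (\<beta> B\<^sub>n) powr r)\<close>, the prior mass outside the box (\<open>thin_tail_prior_tail\<close>), plus
  \<open>exp (- n (\<delta>\<^sub>n - K \<lambda>\<^sub>n) / 2)\<close>.
  
  The normalising constant is bounded below by the contribution of a small ball around the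
  coefficients of the sieve approximation.  Conditional means are Lipschitz in the coefficients, in
  the \<open>L\<^sup>1\<close> sense (\<open>sieve_residual_mean_lipschitz\<close>), and they are bounded by \<open>\<gamma>\<close>; hence the criterion
  exceeds its value at the centre by at most \<open>2 C \<gamma> \<epsilon>\<close> on the ball of radius \<open>\<epsilon>\<close>
  (\<open>crit_le_of_close\<close>).  With \<open>\<epsilon> = exp (- n \<lambda>\<^sub>n / q\<^sub>n)\<close> this excess is one of the terms of the rate,
  while the prior mass of the ball is \<open>exp (- n \<lambda>\<^sub>n)\<close> up to factors exponential in \<open>q\<^sub>n\<close>
  (\<open>thin_tail_prior_ball\<close>).  Since \<open>\<gamma> \<ge> 1\<close>, smallness of \<open>\<gamma> \<epsilon>\<close> forces \<open>q\<^sub>n\<close> to be of smaller order than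
  \<open>n \<lambda>\<^sub>n\<close>.  Therefore the normalising constant is at least \<open>exp (- L n rate\<^sub>n)\<close> for a constant
  \<open>L\<close>, and \<open>n rate\<^sub>n\<close> is negligible against both exponents of the numerator
  (\<open>posterior_odds_bound\<close>).
  
  The prior integrals reduce to one dimension because the norm of the coefficients has an explicit
  radial density under Lebesgue measure (\<open>distr_coeff_L2_set\<close>).
\<close>

section \<open>Radial integration and the thin-tail prior\<close>

lemma sphere_area_eq_unit_ball_vol:
  assumes "q > 0"
  shows "sphere_area q = real q * unit_ball_vol (real q)"
proof -
  have "Gamma (real q / 2 + 1) = real q / 2 * Gamma (real q / 2)"
    by (rule Gamma_plus1) (use assms in \<open>auto simp: nonpos_Ints_def\<close>)
  then show ?thesis
    unfolding sphere_area_def unit_ball_vol_def by (simp only:) (use assms in simp)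
qed

lemma sphere_area_pos: "q > 0 \<Longrightarrow> sphere_area q > 0"
  by (simp add: sphere_area_eq_unit_ball_vol)

lemma measurable_coeff_L2_set [measurable]:
  "(\<lambda>b. L2_set (\<lambda>i. b i - c i) {..<q}) \<in> borel_measurable (coeff_space q)"
  "(\<lambda>b. L2_set b {..<q}) \<in> borel_measurable (coeff_space q)"
  unfolding L2_set_def by measurable

text \<open>
  The library computes the volume of balls of positive radius only; the degenerate ball is
  squeezed between the empty set and balls of radius tending to \<open>0\<close>.
\<close>

lemma emeasure_coeff_ball:
  assumes "q > 0" "t \<ge> 0"
  shows "emeasure (coeff_space q) {b \<in> space (coeff_space q). L2_set b {..<q} \<le> t} =
           ennreal (unit_ball_vol (real q) * t ^ q)"
proof -
  let ?B = "\<lambda>t. {b \<in> space (coeff_space q). L2_set b {..<q} \<le> t}"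
  have pos: "emeasure (coeff_space q) (?B t) = ennreal (unit_ball_vol (real q) * t ^ q)"
    if "t > 0" for t
    using emeasure_cball_aux[of "{..<q}" t] that
    by (simp add: L2_set_def Int_def conj_commute)
  show ?thesis
  proof (cases "t > 0")
    case False
    with assms have t: "t = 0" by simp
    have lim: "((\<lambda>t. ennreal (unit_ball_vol (real q) * t ^ q)) \<longlongrightarrow>
            ennreal (unit_ball_vol (real q) * 0 ^ q)) (at_right 0)"
      by (intro tendsto_intros)
    have "emeasure (coeff_space q) (?B 0) \<le> ennreal (unit_ball_vol (real q) * 0 ^ q)"
    proof (rule tendsto_lowerbound[OF lim])
      show "\<forall>\<^sub>F t in at_right 0. emeasure (coeff_space q) (?B 0)
              \<le> ennreal (unit_ball_vol (real q) * t ^ q)"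
      proof (rule eventually_at_right_less[THEN eventually_mono])
        fix t :: real assume "0 < t"
        then have "emeasure (coeff_space q) (?B 0) \<le> emeasure (coeff_space q) (?B t)"
          by (intro emeasure_mono) auto
        with pos[OF \<open>0 < t\<close>] show "emeasure (coeff_space q) (?B 0)
              \<le> ennreal (unit_ball_vol (real q) * t ^ q)" by simp
      qed
    qed simp
    then show ?thesis using assms t by (simp add: zero_power)
  qed (rule pos)
qed

text \<open>
  Polar coordinates for radial functions: differentiating the ball volume
  \<open>unit_ball_vol q * t ^ q\<close> shows that under Lebesgue measure the Euclidean norm has density
  \<open>sphere_area q * t ^ (q - 1)\<close> on the positive half-line.
\<close>

lemma distr_coeff_L2_set:
  assumes q: "q > 0"
  shows "distr (coeff_space q) borel (\<lambda>b. L2_set b {..<q}) =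
           density lborel (\<lambda>t. ennreal (sphere_area q * t ^ (q - 1)) * indicator {0..} t)"
    (is "?N1 = ?N2")
proof (rule measure_eqI_generator_eq[where E = "range atMost" and \<Omega> = UNIV and A = "\<lambda>i. {..real i}"])
  let ?V = "unit_ball_vol (real q)"
  have ball: "emeasure ?N1 {..t} = (if t < 0 then 0 else ennreal (?V * t ^ q))" for t
  proof -
    have "emeasure ?N1 {..t} = emeasure (coeff_space q) {b \<in> space (coeff_space q). L2_set b {..<q} \<le> t}"
    proof -
      have "emeasure ?N1 {..t} =
          emeasure (coeff_space q) ((\<lambda>b. L2_set b {..<q}) -` {..t} \<inter> space (coeff_space q))"
        by (rule emeasure_distr) auto
      also have "(\<lambda>b. L2_set b {..<q}) -` {..t} \<inter> space (coeff_space q) =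
          {b \<in> space (coeff_space q). L2_set b {..<q} \<le> t}"
        by blast
      finally show ?thesis .
    qed
    also have "\<dots> = (if t < 0 then 0 else ennreal (?V * t ^ q))"
    proof (cases "t < 0")
      case True
      then have "{b \<in> space (coeff_space q). L2_set b {..<q} \<le> t} = {}"
        by (auto simp: not_le intro: less_le_trans[OF _ L2_set_nonneg])
      then show ?thesis using True by (simp only: emeasure_empty if_True)
    qed (use emeasure_coeff_ball[OF q, of t] in simp)
    finally show ?thesis .
  qed
  have dens: "emeasure ?N2 {..t} = (if t < 0 then 0 else ennreal (?V * t ^ q))" for t
  proof -
    have "emeasure ?N2 {..t} = (\<integral>\<^sup>+ s. ennreal (sphere_area q * s ^ (q - 1)) * indicator {0..t} s \<partial>lborel)"
      by (subst emeasure_density) (auto intro!: nn_integral_cong simp: indicator_def)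
    also have "\<dots> = (if t < 0 then 0 else ennreal (?V * t ^ q))"
    proof (cases "t < 0")
      case False
      have "(\<integral>\<^sup>+ s. ennreal (sphere_area q * s ^ (q - 1)) * indicator {0..t} s \<partial>lborel) =
              ennreal (?V * t ^ q - ?V * 0 ^ q)"
      proof (rule nn_integral_FTC_Icc[where F = "\<lambda>s. ?V * s ^ q"])
        fix s :: real assume s: "s \<in> {0..t}"
        show "((\<lambda>s. ?V * s ^ q) has_real_derivative sphere_area q * s ^ (q - 1)) (at s)"
          using q by (auto intro!: derivative_eq_intros simp: sphere_area_eq_unit_ball_vol)
        show "0 \<le> sphere_area q * s ^ (q - 1)"
          using s sphere_area_pos[OF q] by simp
      qed (use False in auto)
      then show ?thesis using False q by simp
    qed simp
    finally show ?thesis .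
  qed
  show "emeasure ?N1 X = emeasure ?N2 X" if "X \<in> range atMost" for X
    using that ball dens by auto
  show "Int_stable (range (atMost :: real \<Rightarrow> _))"
    by (auto simp: Int_stable_def)
  show "sets ?N1 = sigma_sets UNIV (range atMost)"
       "sets ?N2 = sigma_sets UNIV (range atMost)"
    by (simp_all add: borel_eq_atMost)
  show "range (\<lambda>i. {..real i}) \<subseteq> range atMost" by auto
  show "(\<Union>i. {..real i}) = UNIV" by (auto intro: real_arch_simple)
  show "emeasure ?N1 {..real i} \<noteq> \<infinity>" for i by (simp add: ball)
qed auto

lemma nn_integral_coeff_radial:
  assumes "q > 0" and [measurable]: "f \<in> borel_measurable borel"
  shows "(\<integral>\<^sup>+ b. f (L2_set b {..<q}) \<partial>coeff_space q) =
           (\<integral>\<^sup>+ t. ennreal (sphere_area q * t ^ (q - 1)) * indicator {0..} t * f t \<partial>lborel)"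
proof -
  have "(\<integral>\<^sup>+ b. f (L2_set b {..<q}) \<partial>coeff_space q) =
          (\<integral>\<^sup>+ t. f t \<partial>distr (coeff_space q) borel (\<lambda>b. L2_set b {..<q}))"
    by (subst nn_integral_distr) auto
  also have "\<dots> = (\<integral>\<^sup>+ t. ennreal (sphere_area q * t ^ (q - 1)) * indicator {0..} t * f t \<partial>lborel)"
    unfolding distr_coeff_L2_set[OF assms(1)] by (subst nn_integral_density) auto
  finally show ?thesis .
qed

lemma filterlim_powr_at_top:
  fixes r :: real
  assumes "r > 0"
  shows "filterlim (\<lambda>t. t powr r) at_top at_top"
proof -
  have "filterlim (\<lambda>t::real. exp (r * ln t)) at_top at_top"
    using assms
    by (intro filterlim_compose[OF exp_at_top] filterlim_tendsto_pos_mult_at_top[OF tendsto_const])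
       (auto intro: ln_at_top)
  moreover have "\<forall>\<^sub>F t in at_top. exp (r * ln t) = t powr r"
    using eventually_gt_at_top[of 0] by eventually_elim (simp add: powr_def)
  ultimately show ?thesis by (simp add: filterlim_cong[OF refl refl])
qed

lemma thin_tail_density_nonneg:
  assumes "r > 0" "q > 0"
  shows "0 \<le> thin_tail_density r \<beta> q b"
  unfolding thin_tail_density_def using assms sphere_area_pos[of q] by simp

lemma measurable_thin_tail_density [measurable]:
  "thin_tail_density r \<beta> q \<in> borel_measurable (coeff_space q)"
  unfolding thin_tail_density_def by measurable

text \<open>
  The factor \<open>t powr (r - q) / sphere_area q\<close> of the prior density cancels the radial density of
  Lebesgue measure, so that the norm of a prior draw has a Weibull law.
\<close>

lemma thin_tail_prior_tail:
  assumes r: "r > 0" and \<beta>: "\<beta> > 0" and q: "q > 0" and u: "u > 0"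
  shows "(\<integral>\<^sup>+ b. ennreal (thin_tail_density r \<beta> q b) * indicator {u..} (L2_set b {..<q}) \<partial>coeff_space q)
           = ennreal (exp (- (\<beta> powr r * u powr r)))"
proof -
  define f where "f t = r * t powr (r - real q) * \<beta> powr r * exp (- (\<beta> powr r * t powr r)) / sphere_area q"
    for t :: real
  let ?F = "\<lambda>t. - exp (- (\<beta> powr r * t powr r))"
  have [measurable]: "f \<in> borel_measurable borel" unfolding f_def by measurable
  note S = sphere_area_pos[OF q]
  have "(\<integral>\<^sup>+ b. ennreal (thin_tail_density r \<beta> q b) * indicator {u..} (L2_set b {..<q}) \<partial>coeff_space q)
      = (\<integral>\<^sup>+ b. (\<lambda>t. ennreal (f t) * indicator {u..} t) (L2_set b {..<q}) \<partial>coeff_space q)"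
    by (simp add: thin_tail_density_def f_def)
  also have "\<dots> = (\<integral>\<^sup>+ t. ennreal (sphere_area q * t ^ (q - 1)) * indicator {0..} t *
                      (ennreal (f t) * indicator {u..} t) \<partial>lborel)"
    by (rule nn_integral_coeff_radial[OF q]) measurable
  also have "\<dots> = (\<integral>\<^sup>+ t. ennreal (r * \<beta> powr r * t powr (r - 1) * exp (- (\<beta> powr r * t powr r)))
                      * indicator {u..} t \<partial>lborel)"
  proof (intro nn_integral_cong, goal_cases)
    case (1 t)
    show ?case
    proof (cases "u \<le> t")
      case True
      with u have t: "t > 0" by simp
      have "t ^ (q - 1) * t powr (r - real q) = t powr (r - 1)"
        using t q by (simp flip: powr_realpow powr_add add: of_nat_diff)
      then have "sphere_area q * t ^ (q - 1) * f t =
            r * \<beta> powr r * t powr (r - 1) * exp (- (\<beta> powr r * t powr r))"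
        using S by (simp add: f_def field_simps)
      then show ?thesis using t S r True by (simp add: ennreal_mult' [symmetric])
    qed simp
  qed
  also have "\<dots> = ennreal (0 - ?F u)"
  proof (rule nn_integral_FTC_atLeast)
    fix t assume "u \<le> t"
    with u have t: "t > 0" by simp
    show "(?F has_real_derivative r * \<beta> powr r * t powr (r - 1) * exp (- (\<beta> powr r * t powr r))) (at t)"
      using t by (auto intro!: derivative_eq_intros simp: mult_ac)
    show "0 \<le> r * \<beta> powr r * t powr (r - 1) * exp (- (\<beta> powr r * t powr r))" using r by simp
  next
    have "filterlim (\<lambda>t. \<beta> powr r * t powr r) at_top at_top"
      using r \<beta> by (intro filterlim_tendsto_pos_mult_at_top[OF tendsto_const] filterlim_powr_at_top) auto
    then have "((\<lambda>t. - exp (- (\<beta> powr r * t powr r))) \<longlongrightarrow> - 0) at_top"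
      by (intro tendsto_minus filterlim_compose[OF exp_at_bot])
         (simp add: filterlim_uminus_at_bot)
    then show "(?F \<longlongrightarrow> 0) at_top" by simp
  qed auto
  finally show ?thesis by simp
qed

text \<open>
  The total mass is the limit of the tails beyond \<open>1 / (i + 1)\<close>.  The tail formula cannot be used
  at radius \<open>0\<close> directly, because the Weibull distribution function is not differentiable there
  when \<open>r < 1\<close>.
\<close>

lemma thin_tail_prior_total:
  assumes r: "r > 0" and \<beta>: "\<beta> > 0" and q: "q > 0"
  shows "(\<integral>\<^sup>+ b. ennreal (thin_tail_density r \<beta> q b) \<partial>coeff_space q) \<le> 1"
proof -
  let ?g = "\<lambda>i b. ennreal (thin_tail_density r \<beta> q b) * indicator {1 / real (Suc i)..} (L2_set b {..<q})"
  have inc: "incseq ?g"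
  proof (intro incseq_SucI le_funI mult_left_mono)
    fix i and b :: "nat \<Rightarrow> real"
    have "1 / real (Suc (Suc i)) \<le> 1 / real (Suc i)" by (simp add: frac_le)
    then show "indicator {1 / real (Suc i)..} (L2_set b {..<q})
        \<le> (indicator {1 / real (Suc (Suc i))..} (L2_set b {..<q}) :: ennreal)"
      by (auto simp: indicator_def)
  qed simp
  have sup: "(SUP i. ?g i b) = ennreal (thin_tail_density r \<beta> q b)" for b
  proof (cases "L2_set b {..<q} = 0")
    case True then show ?thesis by (simp add: thin_tail_density_def)
  next
    case False
    then have "L2_set b {..<q} > 0" using L2_set_nonneg[of b "{..<q}"] by linarith
    then obtain j where j: "1 / real (Suc j) < L2_set b {..<q}"
      using reals_Archimedean[of "L2_set b {..<q}"] by (auto simp: inverse_eq_divide)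
    show ?thesis
    proof (rule antisym)
      show "(SUP i. ?g i b) \<le> ennreal (thin_tail_density r \<beta> q b)"
        by (rule SUP_least) (simp split: split_indicator)
      show "ennreal (thin_tail_density r \<beta> q b) \<le> (SUP i. ?g i b)"
        by (rule SUP_upper2[of j]) (use j in auto)
    qed
  qed
  have "(\<integral>\<^sup>+ b. ennreal (thin_tail_density r \<beta> q b) \<partial>coeff_space q) =
        (\<integral>\<^sup>+ b. (SUP i. ?g i b) \<partial>coeff_space q)"
    by (simp only: sup)
  also have "\<dots> = (SUP i. \<integral>\<^sup>+ b. ?g i b \<partial>coeff_space q)"
    by (rule nn_integral_monotone_convergence_SUP[OF inc]) measurable
  also have "\<dots> \<le> 1"
    by (rule SUP_least) (subst thin_tail_prior_tail[OF r \<beta> q]; simp)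
  finally show ?thesis .
qed

lemma distr_coeff_translate:
  "distr (coeff_space q) (coeff_space q) (\<lambda>b. \<lambda>i\<in>{..<q}. b i - c i) = coeff_space q"
proof -
  interpret product_sigma_finite "\<lambda>_::nat. lborel :: real measure" by standard
  show ?thesis
  proof (rule PiM_eqI)
    fix A :: "nat \<Rightarrow> real set" assume A: "\<And>i. i \<in> {..<q} \<Longrightarrow> A i \<in> sets lborel"
    have shift: "emeasure lborel {x. x - c i \<in> A i} = emeasure lborel (A i)" if "i \<in> {..<q}" for i
    proof -
      have "emeasure lborel (A i) = emeasure (distr lborel borel ((+) (- c i))) (A i)"
        by (simp add: lborel_distr_plus)
      also have "\<dots> = emeasure lborel {x. x - c i \<in> A i}"
        using A[OF that] by (subst emeasure_distr) (auto simp: vimage_def)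
      finally show ?thesis by simp
    qed
    have [measurable]: "(\<lambda>b. \<lambda>i\<in>{..<q}. b i - c i) \<in> coeff_space q \<rightarrow>\<^sub>M coeff_space q"
      by measurable
    have "emeasure (distr (coeff_space q) (coeff_space q) (\<lambda>b. \<lambda>i\<in>{..<q}. b i - c i)) (Pi\<^sub>E {..<q} A) =
        emeasure (coeff_space q) (Pi\<^sub>E {..<q} (\<lambda>i. {x. x - c i \<in> A i}))"
      using A by (subst emeasure_distr)
        (auto intro!: sets_PiM_I_finite arg_cong[where f = "emeasure _"] simp: space_PiM PiE_def Pi_def)
    also have "\<dots> = (\<Prod>i\<in>{..<q}. emeasure lborel {x. x - c i \<in> A i})"
    proof (rule emeasure_PiM)
      fix i assume "i \<in> {..<q}"
      from A[OF this] have [measurable]: "A i \<in> sets borel" by simp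
      show "{x. x - c i \<in> A i} \<in> sets lborel" by measurable
    qed simp
    finally show "emeasure (distr (coeff_space q) (coeff_space q) (\<lambda>b. \<lambda>i\<in>{..<q}. b i - c i)) (Pi\<^sub>E {..<q} A)
        = (\<Prod>i\<in>{..<q}. emeasure lborel (A i))"
      using shift by simp
  qed auto
qed

lemma emeasure_coeff_ball_centre:
  assumes "q > 0" "\<epsilon> \<ge> 0"
  shows "emeasure (coeff_space q) {b \<in> space (coeff_space q). L2_set (\<lambda>i. b i - c i) {..<q} \<le> \<epsilon>} =
           ennreal (unit_ball_vol (real q) * \<epsilon> ^ q)"
proof -
  let ?B = "{b \<in> space (coeff_space q). L2_set b {..<q} \<le> \<epsilon>}"
  have [measurable]: "(\<lambda>b. \<lambda>i\<in>{..<q}. b i - c i) \<in> coeff_space q \<rightarrow>\<^sub>M coeff_space q"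
    by measurable
  have "ennreal (unit_ball_vol (real q) * \<epsilon> ^ q) =
      emeasure (distr (coeff_space q) (coeff_space q) (\<lambda>b. \<lambda>i\<in>{..<q}. b i - c i)) ?B"
    unfolding distr_coeff_translate emeasure_coeff_ball[OF assms] ..
  also have "\<dots> = emeasure (coeff_space q) ((\<lambda>b. \<lambda>i\<in>{..<q}. b i - c i) -` ?B \<inter> space (coeff_space q))"
    by (subst emeasure_distr) measurable
  also have "(\<lambda>b. \<lambda>i\<in>{..<q}. b i - c i) -` ?B \<inter> space (coeff_space q) =
      {b \<in> space (coeff_space q). L2_set (\<lambda>i. b i - c i) {..<q} \<le> \<epsilon>}"
    by (auto simp: space_PiM L2_set_def)
  finally show ?thesis ..
qed

text \<open>
  The prior mass near a centre \<open>c\<close> decides how fast the normalising constant of the posterior can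
  decay.  On the ball the density is at least its value at radius \<open>R\<close>, the dimensional constants of
  the density and of the ball volume cancel up to a factor \<open>q\<close>, and what remains is exponential in
  \<open>q\<close>, with base \<open>\<epsilon> / R\<close>.
\<close>

lemma thin_tail_prior_ball:
  assumes r: "r > 0" and \<beta>: "\<beta> > 0" and q: "q > 0" "real q \<ge> r" and \<epsilon>: "\<epsilon> > 0"
    and R: "L2_set c {..<q} + \<epsilon> \<le> R" "R \<ge> 1"
  shows "ennreal (r * \<beta> powr r * exp (- (\<beta> powr r * R powr r)) / real q * (\<epsilon> / R) ^ q)
     \<le> (\<integral>\<^sup>+ b. ennreal (thin_tail_density r \<beta> q b) *
            indicator {b \<in> space (coeff_space q). L2_set (\<lambda>i. b i - c i) {..<q} \<le> \<epsilon>} b \<partial>coeff_space q)"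
proof -
  let ?U = "{b \<in> space (coeff_space q). L2_set (\<lambda>i. b i - c i) {..<q} \<le> \<epsilon>}"
  define p where "p = r * \<beta> powr r * exp (- (\<beta> powr r * R powr r)) / (real q * unit_ball_vol (real q)) / R ^ q"
  have p: "p \<ge> 0" using r R by (simp add: p_def)
  \<comment> \<open>At the origin the density has the junk value 0 (a power of 0), which violates
    the lower bound; the origin is a null set.\<close>
  have "AE b in coeff_space q. L2_set b {..<q} \<noteq> 0"
  proof (rule AE_I)
    show "{b \<in> space (coeff_space q). \<not> L2_set b {..<q} \<noteq> 0}
        \<subseteq> {b \<in> space (coeff_space q). L2_set b {..<q} \<le> 0}" by auto
    show "emeasure (coeff_space q) {b \<in> space (coeff_space q). L2_set b {..<q} \<le> 0} = 0"
      by (subst emeasure_coeff_ball) (use q in auto)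
  qed measurable
  then have ae: "AE b in coeff_space q. ennreal p * indicator ?U b
      \<le> ennreal (thin_tail_density r \<beta> q b) * indicator ?U b"
  proof (rule AE_mp, intro AE_I2 impI)
    fix b assume nz: "L2_set b {..<q} \<noteq> 0"
    show "ennreal p * indicator ?U b \<le> ennreal (thin_tail_density r \<beta> q b) * indicator ?U b"
    proof (cases "b \<in> ?U")
      case True
      let ?t = "L2_set b {..<q}"
      have t0: "?t > 0" using nz L2_set_nonneg[of b "{..<q}"] by linarith
      have "?t \<le> L2_set (\<lambda>i. b i - c i) {..<q} + L2_set c {..<q}"
        using L2_set_triangle_ineq[of "\<lambda>i. b i - c i" c "{..<q}"] by simp
      with True R have tR: "?t \<le> R" by simp
      have "1 / R ^ q = R powr (- real q)"
        using R by (simp add: powr_minus powr_realpow divide_inverse)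
      also have "\<dots> \<le> R powr (r - real q)" using R r by (intro powr_mono) auto
      also have "\<dots> \<le> ?t powr (r - real q)" using t0 tR q by (intro powr_mono2') auto
      finally have 1: "1 / R ^ q \<le> ?t powr (r - real q)" .
      have "?t powr r \<le> R powr r" using t0 tR r by (intro powr_mono2) auto
      then have 2: "exp (- (\<beta> powr r * R powr r)) \<le> exp (- (\<beta> powr r * ?t powr r))"
        using \<beta> by simp
      have "p = r * (1 / R ^ q) * \<beta> powr r * exp (- (\<beta> powr r * R powr r)) / sphere_area q"
        using q by (simp add: p_def sphere_area_eq_unit_ball_vol)
      also have "\<dots> \<le> thin_tail_density r \<beta> q b"
        unfolding thin_tail_density_def
        using 1 2 r R sphere_area_pos[OF q(1)]
        by (intro divide_right_mono mult_mono) auto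
      finally show ?thesis using True by (simp add: ennreal_leI)
    qed simp
  qed
  have "ennreal (r * \<beta> powr r * exp (- (\<beta> powr r * R powr r)) / real q * (\<epsilon> / R) ^ q) =
      ennreal (p * (unit_ball_vol (real q) * \<epsilon> ^ q))"
  proof (rule arg_cong[where f = ennreal])
    have "unit_ball_vol (real q) \<noteq> 0" using unit_ball_vol_pos[of "real q"] by linarith
    then show "r * \<beta> powr r * exp (- (\<beta> powr r * R powr r)) / real q * (\<epsilon> / R) ^ q =
        p * (unit_ball_vol (real q) * \<epsilon> ^ q)"
      by (simp add: p_def power_divide)
  qed
  also have "\<dots> = ennreal p * emeasure (coeff_space q) ?U"
    using \<epsilon> q p by (simp add: ennreal_mult' emeasure_coeff_ball_centre)
  also have "\<dots> = (\<integral>\<^sup>+ b. ennreal p * indicator ?U b \<partial>coeff_space q)"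
    by (rule nn_integral_cmult_indicator[symmetric]) measurable
  also have "\<dots> \<le> (\<integral>\<^sup>+ b. ennreal (thin_tail_density r \<beta> q b) * indicator ?U b \<partial>coeff_space q)"
    by (rule nn_integral_mono_AE[OF ae])
  finally show ?thesis .
qed

section \<open>The criterion as a function of the sieve coefficients\<close>

lemma measurable_snd_borel [measurable]: "snd \<in> borel \<rightarrow>\<^sub>M borel"
  by (intro borel_measurable_continuous_onI continuous_on_snd continuous_on_id)

text \<open>
  Conditional Jensen: passing to conditional means does not increase the \<open>L\<^sup>1\<close> distance.
\<close>

lemma cond_mean_L1_contraction:
  assumes P: "prob_space P" "sets P = sets borel"
    and int: "integrable P (\<lambda>p. f1 (fst p))" "integrable P (\<lambda>p. f2 (fst p))"
    and h: "cond_mean_version P f1 h1" "cond_mean_version P f2 h2"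
  shows "integrable P (\<lambda>p. h1 (snd p) - h2 (snd p))"
    and "(\<integral>p. \<bar>h1 (snd p) - h2 (snd p)\<bar> \<partial>P) \<le> (\<integral>p. \<bar>f1 (fst p) - f2 (fst p)\<bar> \<partial>P)"
proof -
  interpret prob_space P by fact
  let ?F = "vimage_algebra (space P) snd borel"
  have snd: "snd \<in> P \<rightarrow>\<^sub>M (borel :: (real ^ 'b) measure)"
    unfolding measurable_cong_sets[OF P(2) refl] by simp
  have "sets ?F \<subseteq> sets P"
    unfolding sets_vimage_algebra
    by (rule sets.sigma_sets_subset) (use measurable_sets[OF snd] in auto)
  then interpret finite_measure_subalgebra P ?F
    by unfold_locales (auto simp: subalgebra_def)
  let ?d = "\<lambda>p. f1 (fst p) - f2 (fst p)"
  let ?e = "real_cond_exp P ?F ?d"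
  have d: "integrable P ?d" using int by simp
  have e: "integrable P ?e" by (rule real_cond_exp_int(1)[OF d])
  have h_meas [measurable]: "(\<lambda>p. h1 (snd p)) \<in> borel_measurable P" "(\<lambda>p. h2 (snd p)) \<in> borel_measurable P"
    using h snd by (auto simp: cond_mean_version_def intro: measurable_compose)
  have ae: "AE p in P. h1 (snd p) - h2 (snd p) = ?e p"
    using real_cond_exp_diff[OF int] h unfolding cond_mean_version_def
    by (auto elim: AE_mp)
  show "integrable P (\<lambda>p. h1 (snd p) - h2 (snd p))"
    by (subst integrable_cong_AE[OF _ _ ae]) (use e in auto)
  have "(\<integral>p. \<bar>h1 (snd p) - h2 (snd p)\<bar> \<partial>P) = (\<integral>p. \<bar>?e p\<bar> \<partial>P)"
    by (rule integral_cong_AE) (use ae e in auto)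
  also have "\<dots> \<le> (\<integral>p. real_cond_exp P ?F (\<lambda>p. \<bar>?d p\<bar>) p \<partial>P)"
  proof (rule integral_mono_AE)
    have "AE p in P. real_cond_exp P ?F (\<lambda>p. - \<bar>?d p\<bar>) p \<le> ?e p"
         "AE p in P. ?e p \<le> real_cond_exp P ?F (\<lambda>p. \<bar>?d p\<bar>) p"
      by (rule real_cond_exp_mono; use d in auto)+
    moreover have "AE p in P. real_cond_exp P ?F (\<lambda>p. (-1) * \<bar>?d p\<bar>) p = (-1) * real_cond_exp P ?F (\<lambda>p. \<bar>?d p\<bar>) p"
      by (rule real_cond_exp_cmult) (use d in auto)
    ultimately show "AE p in P. \<bar>?e p\<bar> \<le> real_cond_exp P ?F (\<lambda>p. \<bar>?d p\<bar>) p"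
      by eventually_elim (auto simp: abs_le_iff)
    show "integrable P (real_cond_exp P ?F (\<lambda>p. \<bar>?d p\<bar>))"
      by (rule real_cond_exp_int(1)) (use d in auto)
  qed (use e in auto)
  also have "\<dots> = (\<integral>p. \<bar>?d p\<bar> \<partial>P)"
    by (rule real_cond_exp_int(2)) (use d in auto)
  finally show "(\<integral>p. \<bar>h1 (snd p) - h2 (snd p)\<bar> \<partial>P) \<le> (\<integral>p. \<bar>?d p\<bar> \<partial>P)" .
qed

lemma (in prob_space) expectation_abs_le_sqrt:
  fixes f :: "'a \<Rightarrow> real"
  assumes [measurable]: "f \<in> borel_measurable M" and f2: "integrable M (\<lambda>x. (f x)\<^sup>2)"
  shows "expectation (\<lambda>x. \<bar>f x\<bar>) \<le> sqrt (expectation (\<lambda>x. (f x)\<^sup>2))"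
proof -
  have f: "integrable M f" by (rule square_integrable_imp_integrable) (use f2 in auto)
  have "0 \<le> variance (\<lambda>x. \<bar>f x\<bar>)" by (rule variance_positive)
  also have "\<dots> = expectation (\<lambda>x. (f x)\<^sup>2) - (expectation (\<lambda>x. \<bar>f x\<bar>))\<^sup>2"
    using f f2 by (subst variance_eq) auto
  finally show ?thesis by (intro real_le_rsqrt) simp
qed

lemma val_sieve_AE:
  assumes "function_space P cov val"
  shows "AE p in P. val (sieve \<phi> q b) (cov p) = (\<Sum>i<q. b i * val (\<phi> i) (cov p))"
proof (induction q)
  have lin: "AE p in P. val (a *\<^sub>R g + h) (cov p) = a * val g (cov p) + val h (cov p)" for a g h
    using assms unfolding function_space_def by blast
  case 0
  show ?case using lin[of 1 0 0] by (simp add: sieve_def)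
next
  have lin: "AE p in P. val (a *\<^sub>R g + h) (cov p) = a * val g (cov p) + val h (cov p)" for a g h
    using assms unfolding function_space_def by blast
  case (Suc q)
  have "AE p in P. val (b q *\<^sub>R \<phi> q + sieve \<phi> q b) (cov p) = b q * val (\<phi> q) (cov p) + val (sieve \<phi> q b) (cov p)"
    by (rule lin)
  with Suc show ?case
    by eventually_elim (simp add: sieve_def add.commute)
qed

text \<open>
  Orthonormality of the basis turns the Euclidean geometry of the coefficients into the
  \<open>L\<^sup>2\<close> geometry of the sieve functions.
\<close>

lemma sieve_L2_isometry:
  assumes fs: "function_space P cov val" and P: "sets P = sets borel"
    and cov: "cov \<in> borel_measurable borel"
    and orth: "\<And>i j. i < q \<Longrightarrow> j < q \<Longrightarrow>
            (\<integral>p. val (\<phi> i) (cov p) * val (\<phi> j) (cov p) \<partial>P) = (if i = j then 1 else 0)"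
  shows "(\<integral>p. (val (sieve \<phi> q b) (cov p))\<^sup>2 \<partial>P) = (L2_set b {..<q})\<^sup>2"
proof -
  note [measurable_cong] = P
  note [measurable] = cov
  have [measurable]: "val g \<in> borel_measurable borel" for g
    using fs by (simp add: function_space_def)
  have sq: "integrable P (\<lambda>p. (val g (cov p))\<^sup>2)" for g
    using fs by (simp add: function_space_def)
  have prod: "integrable P (\<lambda>p. val g (cov p) * val h (cov p))" for g h
  proof (rule Bochner_Integration.integrable_bound)
    show "integrable P (\<lambda>p. (val g (cov p))\<^sup>2 + (val h (cov p))\<^sup>2)" using sq by simp
    show "AE p in P. norm (val g (cov p) * val h (cov p)) \<le> norm ((val g (cov p))\<^sup>2 + (val h (cov p))\<^sup>2)"
    proof (intro AE_I2)
      fix p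
      have "\<bar>x * y\<bar> \<le> x\<^sup>2 + y\<^sup>2" for x y :: real
        using sum_squares_bound[of "\<bar>x\<bar>" "\<bar>y\<bar>"] mult_nonneg_nonneg[of "\<bar>x\<bar>" "\<bar>y\<bar>"]
        by (simp only: abs_mult power2_abs) linarith
      then show "norm (val g (cov p) * val h (cov p)) \<le> norm ((val g (cov p))\<^sup>2 + (val h (cov p))\<^sup>2)"
        by simp
    qed
  qed measurable
  have "(\<integral>p. (val (sieve \<phi> q b) (cov p))\<^sup>2 \<partial>P) = (\<integral>p. (\<Sum>i<q. b i * val (\<phi> i) (cov p))\<^sup>2 \<partial>P)"
    by (rule integral_cong_AE) (use val_sieve_AE[OF fs, of \<phi> q b] in auto)
  also have "\<dots> = (\<integral>p. (\<Sum>i<q. \<Sum>j<q. b i * b j * (val (\<phi> i) (cov p) * val (\<phi> j) (cov p))) \<partial>P)"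
    by (simp add: power2_eq_square sum_product mult_ac)
  also have "\<dots> = (\<Sum>i<q. \<Sum>j<q. b i * b j * (\<integral>p. val (\<phi> i) (cov p) * val (\<phi> j) (cov p) \<partial>P))"
    using prod by simp
  also have "\<dots> = (\<Sum>i<q. \<Sum>j<q. if i = j then b i * b j else 0)"
    using orth by (intro sum.cong) auto
  also have "\<dots> = (L2_set b {..<q})\<^sup>2"
    by (simp add: L2_set_def sum_nonneg power2_eq_square)
  finally show ?thesis .
qed

text \<open>
  From \<open>x\<^sup>2 - y\<^sup>2 = (x + y) (x - y)\<close>: where the conditional means are bounded, the quadratic
  criterion is controlled by their \<open>L\<^sup>1\<close> distance.
\<close>

lemma crit_le_of_close:
  assumes P: "prob_space P" "sets P = sets borel"
    and h [measurable]: "m g1 \<in> borel_measurable borel" "m g2 \<in> borel_measurable borel"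
    and int: "integrable P (\<lambda>p. m g1 (snd p) - m g2 (snd p))"
    and bound: "AE p in P. \<bar>m g1 (snd p)\<bar> \<le> K" "AE p in P. \<bar>m g2 (snd p)\<bar> \<le> K"
  shows "crit P m g1 \<le> crit P m g2 + ereal (2 * K * (\<integral>p. \<bar>m g1 (snd p) - m g2 (snd p)\<bar> \<partial>P))"
proof -
  interpret prob_space P by fact
  note [measurable_cong] = P(2)
  let ?d = "\<lambda>p. 2 * K * \<bar>m g1 (snd p) - m g2 (snd p)\<bar>"
  have "AE p in P. 0 \<le> K"
    using bound(1) by eventually_elim (meson abs_ge_zero order_trans)
  then have K: "K \<ge> 0" by simp
  have "(\<integral>\<^sup>+ p. ennreal ((m g1 (snd p))\<^sup>2) \<partial>P)
      \<le> (\<integral>\<^sup>+ p. ennreal ((m g2 (snd p))\<^sup>2) + ennreal (?d p) \<partial>P)"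
  proof (rule nn_integral_mono_AE)
    show "AE p in P. ennreal ((m g1 (snd p))\<^sup>2) \<le> ennreal ((m g2 (snd p))\<^sup>2) + ennreal (?d p)"
      using bound
    proof eventually_elim
      case (elim p)
      let ?x = "m g1 (snd p)" and ?y = "m g2 (snd p)"
      have "?x\<^sup>2 - ?y\<^sup>2 = (?x + ?y) * (?x - ?y)" by (simp add: power2_eq_square algebra_simps)
      also have "\<dots> \<le> \<bar>?x + ?y\<bar> * \<bar>?x - ?y\<bar>" by (metis abs_ge_self abs_mult)
      also have "\<dots> \<le> 2 * K * \<bar>?x - ?y\<bar>"
        using elim by (intro mult_right_mono) auto
      finally have "?x\<^sup>2 \<le> ?y\<^sup>2 + ?d p" by simp
      then show ?case using K by (simp flip: ennreal_plus add: ennreal_leI)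
    qed
  qed
  also have "\<dots> = (\<integral>\<^sup>+ p. ennreal ((m g2 (snd p))\<^sup>2) \<partial>P) + (\<integral>\<^sup>+ p. ennreal (?d p) \<partial>P)"
    by (rule nn_integral_add) measurable
  also have "(\<integral>\<^sup>+ p. ennreal (?d p) \<partial>P) = ennreal (\<integral>p. ?d p \<partial>P)"
    using int K by (intro nn_integral_eq_integral) auto
  finally have "crit P m g1 \<le> enn2ereal ((\<integral>\<^sup>+ p. ennreal ((m g2 (snd p))\<^sup>2) \<partial>P) + ennreal (\<integral>p. ?d p \<partial>P))"
    unfolding crit_def by (simp add: less_eq_ennreal.rep_eq)
  also have "\<dots> = crit P m g2 + ereal (2 * K * (\<integral>p. \<bar>m g1 (snd p) - m g2 (snd p)\<bar> \<partial>P))"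
    using K unfolding crit_def by (simp add: plus_ennreal.rep_eq enn2ereal_ennreal integral_nonneg_AE)
  finally show ?thesis .
qed

text \<open>
  Truncation makes the second moment finite, and hence \<open>L\<^sup>1\<close>-continuous in the conditional mean; the
  criterion itself is only lower semicontinuous.
\<close>

lemma crit_eq_SUP_truncated:
  fixes P :: "('z::euclidean_space \<times> (real ^ 'd)) measure"
  assumes P: "prob_space P" "sets P = sets borel"
    and [measurable]: "m g \<in> borel_measurable borel"
  shows "crit P m g = enn2ereal (SUP N. ennreal (\<integral>p. (min \<bar>m g (snd p)\<bar> (real N))\<^sup>2 \<partial>P))"
proof -
  interpret prob_space P by fact
  note [measurable_cong] = P(2)
  let ?f = "\<lambda>N p. ennreal ((min \<bar>m g (snd p)\<bar> (real N))\<^sup>2)"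
  have inc: "incseq ?f"
    by (intro incseq_SucI le_funI ennreal_leI power_mono) auto
  have "(SUP N. ?f N p) = ennreal ((m g (snd p))\<^sup>2)" for p :: "'z \<times> (real ^ 'd)"
  proof (rule antisym)
    show "(SUP N. ?f N p) \<le> ennreal ((m g (snd p))\<^sup>2)"
      by (rule SUP_least) (auto intro!: ennreal_leI simp: abs_le_square_iff[symmetric])
    obtain N where N: "\<bar>m g (snd p)\<bar> \<le> real N" using real_arch_simple by blast
    show "ennreal ((m g (snd p))\<^sup>2) \<le> (SUP N. ?f N p)"
      by (rule SUP_upper2[of N]) (use N in \<open>auto simp: min_def\<close>)
  qed
  then have "(\<integral>\<^sup>+ p. ennreal ((m g (snd p))\<^sup>2) \<partial>P) = (\<integral>\<^sup>+ p. (SUP N. ?f N p) \<partial>P)" by (simp only:)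
  also have "\<dots> = (SUP N. \<integral>\<^sup>+ p. ?f N p \<partial>P)"
    by (rule nn_integral_monotone_convergence_SUP[OF inc]) measurable
  also have "\<dots> = (SUP N. ennreal (\<integral>p. (min \<bar>m g (snd p)\<bar> (real N))\<^sup>2 \<partial>P))"
  proof (intro SUP_cong refl nn_integral_eq_integral)
    fix N
    show "integrable P (\<lambda>p. (min \<bar>m g (snd p)\<bar> (real N))\<^sup>2)"
      by (rule integrable_const_bound[of _ "(real N)\<^sup>2"]) (auto intro!: power_mono)
  qed auto
  finally show ?thesis unfolding crit_def by simp
qed

text \<open>
  The posterior is asked for the mass of a sublevel set of the criterion.  The integral over that
  set would be a default value if the set were not measurable; it is, because the criterion is a
  countable supremum of functions that are continuous in the coefficients.
\<close>

lemma measurable_crit_sieve: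
  assumes P: "prob_space P" "sets P = sets borel"
    and m [measurable]: "\<And>g. m g \<in> borel_measurable borel"
    and int: "\<And>b b'. integrable P (\<lambda>p. m (sieve \<phi> q b) (snd p) - m (sieve \<phi> q b') (snd p))"
    and lip: "\<And>b b'. (\<integral>p. \<bar>m (sieve \<phi> q b) (snd p) - m (sieve \<phi> q b') (snd p)\<bar> \<partial>P)
                \<le> C * L2_set (\<lambda>i. b i - b' i) {..<q}"
  shows "(\<lambda>b. crit P m (sieve \<phi> q b)) \<in> borel_measurable (coeff_space q)"
proof -
  interpret prob_space P by fact
  note [measurable_cong] = P(2)
  let ?F = "\<lambda>N b. \<integral>p. (min \<bar>m (sieve \<phi> q b) (snd p)\<bar> (real N))\<^sup>2 \<partial>P"
  have int_tr: "integrable P (\<lambda>p. (min \<bar>m (sieve \<phi> q b) (snd p)\<bar> (real N))\<^sup>2)" for N b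
    by (rule integrable_const_bound[of _ "(real N)\<^sup>2"]) (auto intro!: power_mono)
  have diff: "norm (?F N b - ?F N a) \<le> 2 * real N * (C * L2_set (\<lambda>i. b i - a i) {..<q})" for N a b
  proof -
    have "norm (?F N b - ?F N a) \<le>
        (\<integral>p. \<bar>(min \<bar>m (sieve \<phi> q b) (snd p)\<bar> (real N))\<^sup>2 - (min \<bar>m (sieve \<phi> q a) (snd p)\<bar> (real N))\<^sup>2\<bar> \<partial>P)"
      using integral_norm_bound[of P "\<lambda>p. (min \<bar>m (sieve \<phi> q b) (snd p)\<bar> (real N))\<^sup>2 - (min \<bar>m (sieve \<phi> q a) (snd p)\<bar> (real N))\<^sup>2"]
        int_tr by simp
    also have "\<dots> \<le> (\<integral>p. 2 * real N * \<bar>m (sieve \<phi> q b) (snd p) - m (sieve \<phi> q a) (snd p)\<bar> \<partial>P)"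
    proof (rule integral_mono)
      fix p
      let ?x = "m (sieve \<phi> q b) (snd p)" and ?y = "m (sieve \<phi> q a) (snd p)"
      let ?u = "min \<bar>?x\<bar> (real N)" and ?v = "min \<bar>?y\<bar> (real N)"
      have "\<bar>?u\<^sup>2 - ?v\<^sup>2\<bar> = \<bar>?u + ?v\<bar> * \<bar>?u - ?v\<bar>"
        by (subst abs_mult [symmetric]) (simp add: power2_eq_square algebra_simps)
      also have "\<dots> \<le> (2 * real N) * \<bar>?x - ?y\<bar>"
        by (intro mult_mono) auto
      finally show "\<bar>?u\<^sup>2 - ?v\<^sup>2\<bar> \<le> 2 * real N * \<bar>?x - ?y\<bar>" .
    qed (use int_tr int in auto)
    also have "\<dots> \<le> 2 * real N * (C * L2_set (\<lambda>i. b i - a i) {..<q})"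
      using lip[of b a] by (simp add: mult_left_mono)
    finally show ?thesis .
  qed
  have "continuous_on UNIV (?F N)" for N
  proof (simp add: continuous_on_def, intro allI)
    fix a :: "nat \<Rightarrow> real"
    have "continuous_on UNIV (\<lambda>b :: nat \<Rightarrow> real. 2 * real N * (C * L2_set (\<lambda>i. b i - a i) {..<q}))"
      unfolding L2_set_def
      by (intro continuous_intros continuous_on_product_coordinates)
    then have "((\<lambda>b. 2 * real N * (C * L2_set (\<lambda>i. b i - a i) {..<q})) \<longlongrightarrow>
          2 * real N * (C * L2_set (\<lambda>i. a i - a i) {..<q})) (at a)"
      unfolding continuous_on_def by blast
    then have "((\<lambda>b. 2 * real N * (C * L2_set (\<lambda>i. b i - a i) {..<q})) \<longlongrightarrow> 0) (at a)"
      by (simp add: L2_set_def)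
    then have "((\<lambda>b. ?F N b - ?F N a) \<longlongrightarrow> 0) (at a)"
      by (rule Lim_null_comparison[rotated]) (use diff in auto)
    then show "(?F N \<longlongrightarrow> ?F N a) (at a)" by (rule Lim_transform[rotated]) (auto intro: LIM_zero_cancel)
  qed
  then have meas: "?F N \<in> borel_measurable borel" for N
    by (rule borel_measurable_continuous_onI)
  \<comment> \<open>Continuity lives on the full product topology.  Elements of the coefficient space are
    undefined off {..<q}, so the identity into the full product is measurable.\<close>
  have id: "(\<lambda>b. b) \<in> coeff_space q \<rightarrow>\<^sub>M borel"
  proof (rule measurable_coordinatewise_then_product)
    fix i
    show "(\<lambda>b. b i) \<in> borel_measurable (coeff_space q)"
    proof (cases "i < q")
      case False
      then have "b i = undefined" if "b \<in> space (coeff_space q)" for b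
        using that by (auto simp: space_PiM PiE_def extensional_def)
      then show ?thesis by (subst measurable_cong[where g = "\<lambda>_. undefined"]) auto
    qed simp
  qed
  have [measurable]: "(\<lambda>b. ?F N b) \<in> borel_measurable (coeff_space q)" for N
    using measurable_compose[OF id meas[of N]] by simp
  show ?thesis
    unfolding crit_eq_SUP_truncated[OF P m] by measurable
qed

text \<open>
  The chain behind local continuity of the criterion: conditional means contract \<open>L\<^sup>1\<close> distances,
  residuals are Lipschitz in \<open>L\<^sup>1\<close>, \<open>L\<^sup>1\<close> norms are at most \<open>L\<^sup>2\<close> norms, and those are Euclidean
  norms of coefficients.
\<close>

lemma sieve_residual_mean_lipschitz:
  assumes P: "prob_space P" "sets P = sets borel"
    and fs: "function_space P cov val" and cov: "cov \<in> borel_measurable borel"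
    and orth: "\<And>i j. i < q \<Longrightarrow> j < q \<Longrightarrow>
            (\<integral>p. val (\<phi> i) (cov p) * val (\<phi> j) (cov p) \<partial>P) = (if i = j then 1 else 0)"
    and rho: "\<And>g. integrable P (\<lambda>p. \<rho> (fst p) g)"
    and m: "\<And>g. cond_mean_version P (\<lambda>z. \<rho> z g) (m g)"
    and C: "C \<ge> 0" "\<And>g1 g2. (\<integral>p. \<bar>\<rho> (fst p) g1 - \<rho> (fst p) g2\<bar> \<partial>P)
                  \<le> C * (\<integral>p. \<bar>val g1 (cov p) - val g2 (cov p)\<bar> \<partial>P)"
  shows "(\<integral>p. \<bar>m (sieve \<phi> q b) (snd p) - m (sieve \<phi> q b') (snd p)\<bar> \<partial>P)
            \<le> C * L2_set (\<lambda>i. b i - b' i) {..<q}"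
proof -
  interpret prob_space P by fact
  note [measurable_cong] = P(2)
  note [measurable] = cov
  have [measurable]: "val g \<in> borel_measurable borel" for g
    using fs by (simp add: function_space_def)
  let ?d = "sieve \<phi> q (\<lambda>i. b i - b' i)"
  have ae: "AE p in P. val (sieve \<phi> q b) (cov p) - val (sieve \<phi> q b') (cov p) = val ?d (cov p)"
    using val_sieve_AE[OF fs, of \<phi> q b] val_sieve_AE[OF fs, of \<phi> q b']
      val_sieve_AE[OF fs, of \<phi> q "\<lambda>i. b i - b' i"]
    by eventually_elim (simp add: left_diff_distrib sum_subtractf)
  have "(\<integral>p. \<bar>m (sieve \<phi> q b) (snd p) - m (sieve \<phi> q b') (snd p)\<bar> \<partial>P)
      \<le> (\<integral>p. \<bar>\<rho> (fst p) (sieve \<phi> q b) - \<rho> (fst p) (sieve \<phi> q b')\<bar> \<partial>P)"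
    by (rule cond_mean_L1_contraction(2)[OF P rho rho m m])
  also have "\<dots> \<le> C * (\<integral>p. \<bar>val (sieve \<phi> q b) (cov p) - val (sieve \<phi> q b') (cov p)\<bar> \<partial>P)"
    by (rule C)
  also have "\<dots> = C * (\<integral>p. \<bar>val ?d (cov p)\<bar> \<partial>P)"
    by (intro arg_cong2[where f = "(*)"] refl integral_cong_AE) (use ae in auto)
  also have "\<dots> \<le> C * sqrt (\<integral>p. (val ?d (cov p))\<^sup>2 \<partial>P)"
    using C(1) fs by (intro mult_left_mono expectation_abs_le_sqrt) (auto simp: function_space_def)
  also have "(\<integral>p. (val ?d (cov p))\<^sup>2 \<partial>P) = (L2_set (\<lambda>i. b i - b' i) {..<q})\<^sup>2"
    by (rule sieve_L2_isometry[OF fs P(2) cov]) (rule orth)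
  also have "C * sqrt \<dots> = C * L2_set (\<lambda>i. b i - b' i) {..<q}" by simp
  finally show ?thesis .
qed

lemma gamma_bound_ge_one: "gamma_bound m \<phi> q B \<ge> 1" if "B \<ge> 0"
proof -
  have "sieve \<phi> q (\<lambda>_. 0) \<in> sieve_box \<phi> q B"
    unfolding sieve_box_def using that by auto
  moreover have "0 \<in> unit_cube" by (simp add: unit_cube_def)
  ultimately have "0 \<le> (SUP g\<in>sieve_box \<phi> q B. SUP w\<in>unit_cube. ereal \<bar>m g w\<bar>)"
    by (intro SUP_upper2[of "sieve \<phi> q (\<lambda>_. 0)"] SUP_upper2[of 0]) auto
  then show ?thesis unfolding gamma_bound_def by (simp add: add_increasing)
qed

lemma residual_mean_le_gamma_bound:
  assumes "g \<in> sieve_box \<phi> q B" "w \<in> unit_cube" "gamma_bound m \<phi> q B \<le> ereal K"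
  shows "\<bar>m g w\<bar> \<le> K"
proof -
  have "ereal \<bar>m g w\<bar> \<le> (SUP g\<in>sieve_box \<phi> q B. SUP w\<in>unit_cube. ereal \<bar>m g w\<bar>)"
    using assms by (intro SUP_upper2[of g] SUP_upper2[of w]) auto
  also have "\<dots> \<le> gamma_bound m \<phi> q B"
    unfolding gamma_bound_def by (simp add: add_increasing2)
  finally show ?thesis using assms(3) by (metis ereal_less_eq(3) order_trans)
qed

section \<open>Bounding the posterior at a fixed sample\<close>

text \<open>
  The posterior mass outside \<open>S\<close> is a quotient.  The numerator collects the prior mass of \<open>T\<close>, where
  the energy \<open>E\<close> is only known to be nonnegative, and \<open>exp (- a)\<close> from the rest.  The denominator is at least
  the contribution of \<open>U\<close>.
\<close>

lemma gibbs_posterior_bound: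
  fixes p E :: "'b \<Rightarrow> real"
  assumes p [measurable]: "p \<in> borel_measurable N" and E [measurable]: "E \<in> borel_measurable N"
    and S [measurable]: "S \<in> sets N" and T [measurable]: "T \<in> sets N" and U [measurable]: "U \<in> sets N"
    and nonneg: "\<And>b. 0 \<le> p b" "\<And>b. 0 \<le> E b"
    and total: "(\<integral>\<^sup>+ b. ennreal (p b) \<partial>N) \<le> 1"
    and tail: "(\<integral>\<^sup>+ b. ennreal (p b) * indicator T b \<partial>N) \<le> ennreal \<tau>" "\<tau> \<ge> 0"
    and far: "\<And>b. b \<in> space N \<Longrightarrow> b \<notin> S \<Longrightarrow> b \<notin> T \<Longrightarrow> a \<le> E b"
    and near: "ennreal u \<le> (\<integral>\<^sup>+ b. ennreal (p b) * indicator U b \<partial>N)" "u > 0"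
              "\<And>b. b \<in> U \<Longrightarrow> E b \<le> e"
  shows "\<bar>(LINT b:S|N. p b * exp (- E b)) / (LINT b|N. p b * exp (- E b)) - 1\<bar>
           \<le> (\<tau> + exp (- a)) / (u * exp (- e))"
proof -
  let ?f = "\<lambda>b. p b * exp (- E b)"
  have p_int: "integrable N p"
    by (rule integrableI_nonneg) (use nonneg total in \<open>auto intro: le_less_trans\<close>)
  have f: "integrable N ?f"
    by (rule Bochner_Integration.integrable_bound[OF p_int])
       (use nonneg in \<open>auto intro!: AE_I2 simp: abs_mult mult_left_le\<close>)
  have fS: "set_integrable N A ?f" if "A \<in> sets N" for A
    using integrable_mult_indicator[OF that f] by (simp add: set_integrable_def)
  have enn: "ennreal (LINT b:A|N. ?f b) = (\<integral>\<^sup>+ b. ennreal (?f b) * indicator A b \<partial>N)"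
    if [measurable]: "A \<in> sets N" for A
  proof -
    have "ennreal (LINT b:A|N. ?f b) = (\<integral>\<^sup>+ b. ennreal (indicator A b * ?f b) \<partial>N)"
      unfolding set_lebesgue_integral_def
      using fS[OF that] nonneg unfolding set_integrable_def
      by (subst nn_integral_eq_integral) auto
    also have "\<dots> = (\<integral>\<^sup>+ b. ennreal (?f b) * indicator A b \<partial>N)"
      by (intro nn_integral_cong) (auto split: split_indicator)
    finally show ?thesis .
  qed
  let ?D = "LINT b|N. ?f b" and ?J = "LINT b:(space N - S)|N. ?f b"
  have split: "?D = (LINT b:S|N. ?f b) + ?J"
  proof -
    have "?D = (LINT b:(S \<union> (space N - S))|N. ?f b)"
      using sets.sets_into_space[OF S] by (simp add: set_integral_space[OF f, symmetric] Un_absorb1)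
    also have "\<dots> = (LINT b:S|N. ?f b) + ?J"
      by (rule set_integral_Un) (auto intro: fS)
    finally show ?thesis .
  qed
  have "ennreal (u * exp (- e)) = ennreal u * ennreal (exp (- e))"
    using near(2) by (simp add: ennreal_mult)
  also have "\<dots> \<le> (\<integral>\<^sup>+ b. ennreal (p b) * indicator U b \<partial>N) * ennreal (exp (- e))"
    by (intro mult_right_mono near) simp
  also have "\<dots> = (\<integral>\<^sup>+ b. ennreal (p b) * indicator U b * ennreal (exp (- e)) \<partial>N)"
    by (rule nn_integral_multc[symmetric]) measurable
  also have "\<dots> \<le> (\<integral>\<^sup>+ b. ennreal (?f b) \<partial>N)"
    by (intro nn_integral_mono)
       (use nonneg near(3) in \<open>auto split: split_indicator simp flip: ennreal_mult
          intro!: ennreal_leI mult_left_mono\<close>)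
  also have "\<dots> = ennreal ?D"
    by (rule nn_integral_eq_integral[OF f]) (use nonneg in auto)
  finally have D: "u * exp (- e) \<le> ?D"
    using nonneg by (subst (asm) ennreal_le_iff) (auto intro!: integral_nonneg_AE)
  have "ennreal ?J = (\<integral>\<^sup>+ b. ennreal (?f b) * indicator (space N - S) b \<partial>N)"
    by (rule enn) measurable
  also have "\<dots> \<le> (\<integral>\<^sup>+ b. ennreal (p b) * indicator T b + ennreal (p b) * ennreal (exp (- a)) \<partial>N)"
  proof (rule nn_integral_mono)
    fix b assume b: "b \<in> space N"
    show "ennreal (?f b) * indicator (space N - S) b
        \<le> ennreal (p b) * indicator T b + ennreal (p b) * ennreal (exp (- a))"
    proof (cases "b \<in> S \<or> b \<in> T")
      case True
      have "ennreal (?f b) \<le> ennreal (p b)"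
        using nonneg by (intro ennreal_leI) (auto simp: mult_left_le)
      with True b show ?thesis
        by (cases "b \<in> S") (simp_all add: add_increasing2)
    next
      case False
      then have "?f b \<le> p b * exp (- a)"
        using far[OF b] nonneg by (intro mult_left_mono) auto
      then show ?thesis using False b nonneg
        by (simp add: ennreal_leI flip: ennreal_mult)
    qed
  qed
  also have "\<dots> = (\<integral>\<^sup>+ b. ennreal (p b) * indicator T b \<partial>N) + (\<integral>\<^sup>+ b. ennreal (p b) \<partial>N) * ennreal (exp (- a))"
    by (simp add: nn_integral_add nn_integral_multc)
  also have "\<dots> \<le> ennreal \<tau> + 1 * ennreal (exp (- a))"
    by (intro add_mono tail mult_right_mono total) simp
  also have "\<dots> = ennreal (\<tau> + exp (- a))" using tail(2) by simp
  finally have J: "?J \<le> \<tau> + exp (- a)"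
    using tail(2) by (subst (asm) ennreal_le_iff) (auto intro: add_nonneg_nonneg)
  have J0: "?J \<ge> 0"
    unfolding set_lebesgue_integral_def using nonneg by (intro integral_nonneg_AE) auto
  have u: "u * exp (- e) > 0" using near(2) by simp
  with D have Dpos: "?D > 0" by linarith
  have "(LINT b:S|N. ?f b) / ?D - 1 = - (?J / ?D)"
    using split Dpos by (simp add: field_simps)
  then have "\<bar>(LINT b:S|N. ?f b) / ?D - 1\<bar> = ?J / ?D" using J0 Dpos by simp
  also have "\<dots> \<le> (\<tau> + exp (- a)) / (u * exp (- e))"
    using J J0 D u by (intro frac_le) auto
  finally show ?thesis .
qed

lemma emp_crit_nonneg: "0 \<le> emp_crit \<rho> k n s g"
  unfolding emp_crit_def cell_freq_def
  by (intro sum_nonneg divide_nonneg_nonneg mult_nonneg_nonneg) auto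

lemma measurable_emp_crit:
  assumes [measurable]: "\<And>z. (\<lambda>b. \<rho> z (sieve \<phi> q b)) \<in> borel_measurable (coeff_space q)"
  shows "(\<lambda>b. emp_crit \<rho> k n s (sieve \<phi> q b)) \<in> borel_measurable (coeff_space q)"
  unfolding emp_crit_def cell_moment_def by measurable

lemma sieve_in_box:
  assumes "L2_set b {..<q} \<le> B"
  shows "sieve \<phi> q b \<in> sieve_box \<phi> q B"
proof -
  have "\<bar>b i\<bar> \<le> B" if "i < q" for i
  proof -
    have "\<bar>b i\<bar> \<le> L2_set (\<lambda>i. \<bar>b i\<bar>) {..<q}"
      using that by (intro member_le_L2_set) auto
    also have "\<dots> = L2_set b {..<q}" by (simp add: L2_set_def)
    finally show ?thesis using assms by simp
  qed
  then show ?thesis unfolding sieve_box_def by blast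
qed

text \<open>
  The deterministic core of the theorem, at a fixed sample for which the empirical criterion is
  within \<open>\<kappa>\<close> of the true one on the sieve box.  The tail set is the complement of the Euclidean
  ball of radius \<open>B\<close>, which contains the complement of the box; the good set is the ball of radius
  \<open>\<epsilon>\<close> about \<open>c\<close>.
\<close>

lemma quasi_posterior_bound:
  assumes r: "r > 0" and \<beta>: "\<beta> > 0" and q: "q > 0" "real q \<ge> r" and \<epsilon>: "\<epsilon> > 0"
    and R: "L2_set c {..<q} + \<epsilon> \<le> R" "R \<ge> 1" "R \<le> B"
    and rho: "\<And>z. (\<lambda>b. \<rho> z (sieve \<phi> q b)) \<in> borel_measurable (coeff_space q)"
    and crit_meas: "(\<lambda>b. crit P m (sieve \<phi> q b)) \<in> borel_measurable (coeff_space q)"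
    and unif: "\<And>g. g \<in> sieve_box \<phi> q B \<Longrightarrow> \<bar>ereal (emp_crit \<rho> k n s g) - crit P m g\<bar> \<le> ereal \<kappa>"
    and near: "\<And>b. L2_set (\<lambda>i. b i - c i) {..<q} \<le> \<epsilon> \<Longrightarrow> crit P m (sieve \<phi> q b) \<le> ereal G"
  shows "\<bar>quasi_posterior r \<beta> \<rho> \<phi> q k n s
            {b \<in> space (coeff_space q). crit P m (sieve \<phi> q b) < ereal \<delta>} - 1\<bar>
     \<le> (exp (- (\<beta> powr r * B powr r)) + exp (- (real n / 2 * (\<delta> - \<kappa>)))) /
        (r * \<beta> powr r * exp (- (\<beta> powr r * R powr r)) / real q * (\<epsilon> / R) ^ q
          * exp (- (real n / 2 * (G + \<kappa>))))"
proof -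
  note [measurable] = crit_meas measurable_emp_crit[OF rho]
  let ?N = "coeff_space q"
  let ?T = "{b \<in> space ?N. B \<le> L2_set b {..<q}}"
  let ?U = "{b \<in> space ?N. L2_set (\<lambda>i. b i - c i) {..<q} \<le> \<epsilon>}"
  have Bpos: "B > 0" using R by simp
  have crit_real: "crit P m g \<le> ereal (emp_crit \<rho> k n s g + \<kappa>)"
                  "ereal (emp_crit \<rho> k n s g - \<kappa>) \<le> crit P m g"
    if "g \<in> sieve_box \<phi> q B" for g
    using unif[OF that] by (cases "crit P m g"; simp add: abs_le_iff)+
  show ?thesis
    unfolding quasi_posterior_def Let_def mult_minus_left
  proof (rule gibbs_posterior_bound[where T = ?T and U = ?U])
    show "(\<integral>\<^sup>+ b. ennreal (thin_tail_density r \<beta> q b) * indicator ?T b \<partial>?N)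
        \<le> ennreal (exp (- (\<beta> powr r * B powr r)))"
      unfolding thin_tail_prior_tail[OF r \<beta> q(1) Bpos, symmetric]
      by (intro nn_integral_mono) (auto split: split_indicator)
    show "(\<integral>\<^sup>+ b. ennreal (thin_tail_density r \<beta> q b) \<partial>?N) \<le> 1"
      by (rule thin_tail_prior_total[OF r \<beta> q(1)])
    show "ennreal (r * \<beta> powr r * exp (- (\<beta> powr r * R powr r)) / real q * (\<epsilon> / R) ^ q)
        \<le> (\<integral>\<^sup>+ b. ennreal (thin_tail_density r \<beta> q b) * indicator ?U b \<partial>?N)"
      by (rule thin_tail_prior_ball[OF r \<beta> q \<epsilon> R(1,2)])
    show "0 < r * \<beta> powr r * exp (- (\<beta> powr r * R powr r)) / real q * (\<epsilon> / R) ^ q"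
      using r \<beta> q \<epsilon> R by simp
    show "0 \<le> real n / 2 * emp_crit \<rho> k n s (sieve \<phi> q b)" for b
      by (simp add: emp_crit_nonneg)
    show "real n / 2 * (\<delta> - \<kappa>) \<le> real n / 2 * emp_crit \<rho> k n s (sieve \<phi> q b)"
      if "b \<in> space ?N" "b \<notin> {b \<in> space ?N. crit P m (sieve \<phi> q b) < ereal \<delta>}" "b \<notin> ?T" for b
    proof -
      have "L2_set b {..<q} \<le> B" using that by auto
      from crit_real(1)[OF sieve_in_box[OF this]]
      moreover have "ereal \<delta> \<le> crit P m (sieve \<phi> q b)"
        using that by (simp add: not_less)
      ultimately have "ereal \<delta> \<le> ereal (emp_crit \<rho> k n s (sieve \<phi> q b) + \<kappa>)"
        by (rule order_trans[rotated])
      then show ?thesis by (intro mult_left_mono) auto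
    qed
    show "real n / 2 * emp_crit \<rho> k n s (sieve \<phi> q b) \<le> real n / 2 * (G + \<kappa>)" if "b \<in> ?U" for b
    proof -
      have "L2_set b {..<q} \<le> L2_set (\<lambda>i. b i - c i) {..<q} + L2_set c {..<q}"
        using L2_set_triangle_ineq[of "\<lambda>i. b i - c i" c "{..<q}"] by simp
      with that R have "L2_set b {..<q} \<le> B" by simp
      from crit_real(2)[OF sieve_in_box[OF this]] near[of b] that
      have "ereal (emp_crit \<rho> k n s (sieve \<phi> q b) - \<kappa>) \<le> ereal G"
        by (blast intro: order_trans)
      then show ?thesis by (intro mult_left_mono) auto
    qed
  qed (use thin_tail_density_nonneg[OF r q(1)] in \<open>auto intro!: borel_measurable_le\<close>)
qed

text \<open>
  The rate computation.  In the application \<open>x = n \<lambda>\<close>, \<open>y\<close> is \<open>n\<close> times the maximum of the three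
  rates, \<open>w\<close> is the exponent of the prior tail and \<open>d = n \<delta>\<close>.  The radius \<open>\<epsilon> = exp (- x / q)\<close> is
  chosen so that the prior mass costs \<open>\<epsilon> ^ q = exp (- x)\<close>; since \<open>q\<close> is of smaller order than \<open>x\<close>,
  all other losses in the denominator are \<open>O(y)\<close> as well, and \<open>y\<close> is small against both \<open>w\<close>
  and \<open>d\<close>.
\<close>

lemma posterior_odds_bound:
  fixes q :: nat
  assumes q: "q \<ge> 1" and R: "R \<ge> 1" and v: "v > 0"
    and xy: "x \<le> y" and g: "g \<le> c * y" and K: "K \<ge> 0"
    and qx: "real q * (1 + ln R + \<bar>ln v\<bar>) \<le> x"
    and w: "(2 + (c + K) / 2) * y \<le> w / 2"
    and d: "(2 + (c + K) / 2 + K / 2) * y \<le> d / 4" and qd: "real q \<le> d / 4"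
  shows "(exp (- w) + exp (- ((d - K * x) / 2))) /
      (v / real q * (exp (- (x / real q)) / R) ^ q * exp (- ((g + K * x) / 2)))
      \<le> exp (- w / 2) + exp (- real q)"
proof -
  define L where "L = (2 + (c + K) / 2) * y"
  have Kxy: "K * x \<le> K * y" using xy K by (rule mult_left_mono)
  have "exp (- L) \<le> v / real q * (exp (- (x / real q)) / R) ^ q * exp (- ((g + K * x) / 2))"
  proof -
    define l where "l = real q * \<bar>ln v\<bar>"
    have lnv: "- l \<le> ln v"
    proof -
      have "1 * \<bar>ln v\<bar> \<le> l" unfolding l_def using q by (intro mult_right_mono) auto
      then show ?thesis by linarith
    qed
    have lnq: "ln (real q) \<le> real q" using q by (intro less_imp_le ln_less_self) auto
    have e: "L = 2 * y + (c * y + K * y) / 2" by (simp add: L_def algebra_simps add_divide_distrib)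
    have qx': "real q + real q * ln R + l \<le> x" using qx by (simp add: l_def algebra_simps)
    \<comment> \<open>Stated for abstract terms: with the products in place, linear arithmetic would first
      cancel the factor K and lose the comparison.\<close>
    have "- (2 * y + s / 2) \<le> a - b - x - t - u / 2"
      if "- l \<le> a" "b \<le> q'" "q' + t + l \<le> x" "x \<le> y" "u \<le> s" for a b t u s q' :: real
      using that by linarith
    from this[OF lnv lnq qx' xy add_mono[OF g Kxy]]
    have "- L \<le> ln v - ln (real q) - x - real q * ln R - (g + K * x) / 2"
      unfolding e .
    then have "exp (- L) \<le> exp (ln v - ln (real q) - x - real q * ln R - (g + K * x) / 2)" by simp
    also have "\<dots> = v / real q * (exp (- x) / R ^ q) * exp (- ((g + K * x) / 2))"
    proof -
      have "exp (real q * ln R) = R ^ q" using R by (simp add: exp_of_nat_mult)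
      moreover have "exp (a - b - x - t - u) = exp a / exp b * (exp (- x) / exp t) * exp (- u)"
        for a b t u :: real
        by (simp add: exp_add exp_diff exp_minus field_simps)
      ultimately show ?thesis using v q by simp
    qed
    also have "exp (- x) / R ^ q = (exp (- (x / real q)) / R) ^ q"
      using q by (simp add: power_divide flip: exp_of_nat_mult)
    finally show ?thesis .
  qed
  then have "(exp (- w) + exp (- ((d - K * x) / 2))) /
      (v / real q * (exp (- (x / real q)) / R) ^ q * exp (- ((g + K * x) / 2)))
      \<le> (exp (- w) + exp (- ((d - K * x) / 2))) / exp (- L)"
  proof (rule divide_left_mono[OF _ add_nonneg_nonneg])
    show "0 < v / real q * (exp (- (x / real q)) / R) ^ q * exp (- ((g + K * x) / 2)) * exp (- L)"
      using v q R by simp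
  qed auto
  also have "\<dots> = exp (L - w) + exp (L - (d - K * x) / 2)"
    by (simp only: add_divide_distrib flip: exp_diff) (simp add: algebra_simps)
  also have "\<dots> \<le> exp (- w / 2) + exp (- real q)"
  proof (intro add_mono)
    show "exp (L - w) \<le> exp (- w / 2)" using w by (simp add: L_def)
    have "L + K * y / 2 \<le> d / 4" using d by (simp add: L_def algebra_simps)
    moreover have "L + K * x / 2 \<le> L + K * y / 2"
      by (intro add_left_mono divide_right_mono Kxy) simp
    ultimately have "L + K * x / 2 \<le> d / 4" by (rule order_trans[rotated])
    with qd have "L - (d - K * x) / 2 \<le> - real q" by (simp add: diff_divide_distrib)
    then show "exp (L - (d - K * x) / 2) \<le> exp (- real q)" by simp
  qed
  finally show ?thesis .
qed

section \<open>Posterior consistency\<close>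

theorem theorem3p2:
  fixes M :: "'a measure"
    and D :: "nat \<Rightarrow> 'a \<Rightarrow> 'z::euclidean_space \<times> (real ^ 'd)"
    and P :: "('z \<times> (real ^ 'd)) measure"
    and cov :: "'z \<times> (real ^ 'd) \<Rightarrow> 'x::euclidean_space"
    and val :: "'h::banach \<Rightarrow> 'x \<Rightarrow> real"
    and \<rho> :: "'z \<Rightarrow> 'h \<Rightarrow> real"
    and m :: "'h \<Rightarrow> real ^ 'd \<Rightarrow> real"
    and \<phi> :: "nat \<Rightarrow> 'h"
    and q k :: "nat \<Rightarrow> nat"
    and g0 :: 'h
    and bstar :: "nat \<Rightarrow> nat \<Rightarrow> real"
    and B lam \<delta> :: "nat \<Rightarrow> real"
    and r \<beta> C :: real
  defines "gstar \<equiv> \<lambda>n. sieve \<phi> (q n) (bstar n)"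
  defines "rate \<equiv> \<lambda>n. max (crit P m (gstar n)) (max (ereal (lam n))
             (gamma_bound m \<phi> (q n) (B n) * ereal (exp (- (real n * lam n / real (q n))))))"
  assumes M: "prob_space M"
    and A1: "prob_space.indep_vars M (\<lambda>_. borel) D UNIV" "\<And>i. distr M borel (D i) = P"
    and W_range: "AE p in P. snd p \<in> unit_cube"
    and cov: "cov \<in> borel_measurable borel"
    and H: "function_space P cov val"
    and rho: "\<And>g. (\<lambda>z. \<rho> z g) \<in> borel_measurable borel"
             "\<And>g. integrable P (\<lambda>p. \<rho> (fst p) g)"
    and rho_sieve: "\<And>n z. (\<lambda>b. \<rho> z (sieve \<phi> (q n) b)) \<in> borel_measurable (coeff_space (q n))"
    and m: "\<And>g. cond_mean_version P (\<lambda>z. \<rho> z g) (m g)"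
    and q: "filterlim q at_top sequentially"
    and k: "filterlim k at_top sequentially"
    and dense: "closure (\<Union>n. span (\<phi> ` {..<q n})) = UNIV"
    and r: "r > 0" and \<beta>: "\<beta> > 0"
    and B: "filterlim B at_top sequentially"
    and lam: "\<And>n. lam n > 0" "lam \<longlonglongrightarrow> 0"
    and A2: "bounded_in_prob M
               (\<lambda>n \<omega>. SUP g\<in>sieve_box \<phi> (q n) (B n).
                  \<bar>ereal (emp_crit \<rho> (k n) n (\<lambda>i. D i \<omega>) g) - crit P m g\<bar>) lam"
    and A3i: "\<And>n i j. i < q n \<Longrightarrow> j < q n \<Longrightarrow>
               (\<integral>p. val (\<phi> i) (cov p) * val (\<phi> j) (cov p) \<partial>P) = (if i = j then 1 else 0)"
    and A3ii: "g0 \<in> identified_region P m" "(\<lambda>n. norm (gstar n - g0)) \<longlonglongrightarrow> 0"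
    and A4: "C > 0" "\<And>g1 g2. (\<integral>p. \<bar>\<rho> (fst p) g1 - \<rho> (fst p) g2\<bar> \<partial>P)
                  \<le> C * (\<integral>p. \<bar>val g1 (cov p) - val g2 (cov p)\<bar> \<partial>P)"
    and rate_B: "ereal_smallo rate (\<lambda>n. B n powr r / real n)"
    and \<delta>: "\<And>n. \<delta> n > 0" "\<delta> \<in> O(\<lambda>_. 1)"
    and rate_\<delta>: "ereal_smallo rate \<delta>"
  shows "tendsto_in_prob M
           (\<lambda>n \<omega>. quasi_posterior r \<beta> \<rho> \<phi> (q n) (k n) n (\<lambda>i. D i \<omega>)
              {b \<in> space (coeff_space (q n)). crit P m (sieve \<phi> (q n) b) < ereal (\<delta> n)}) 1"
proof -
  interpret M: prob_space M by (rule M)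
  have D0: "D 0 \<in> M \<rightarrow>\<^sub>M borel"
    using A1(1) by (simp add: M.indep_vars_def2)
  have P: "prob_space P" "sets P = sets borel"
    using M.prob_space_distr[OF D0] A1(2)[of 0] by auto
  interpret P: prob_space P by (rule P)
  have m_meas: "m g \<in> borel_measurable borel" for g
    using m[of g] by (simp add: cond_mean_version_def)
  have lip: "(\<integral>p. \<bar>m (sieve \<phi> (q n) b) (snd p) - m (sieve \<phi> (q n) b') (snd p)\<bar> \<partial>P)
      \<le> C * L2_set (\<lambda>i. b i - b' i) {..<q n}" for n b b'
    by (rule sieve_residual_mean_lipschitz[OF P H cov A3i rho(2) m less_imp_le[OF A4(1)] A4(2)])
  have m_int: "integrable P (\<lambda>p. m g (snd p) - m g' (snd p))" for g g'
    by (rule cond_mean_L1_contraction(1)[OF P rho(2) rho(2) m m])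
  have crit_meas: "(\<lambda>b. crit P m (sieve \<phi> (q n) b)) \<in> borel_measurable (coeff_space (q n))" for n
    by (rule measurable_crit_sieve[OF P m_meas m_int lip])

  \<comment> \<open>The sieve approximations converge, so their coefficient vectors stay bounded; the extra 1 in R
    leaves room for a ball of radius at most 1 around them.\<close>
  obtain K0 where K0: "\<And>g. sqrt (\<integral>p. (val g (cov p))\<^sup>2 \<partial>P) \<le> K0 * norm g"
    using H unfolding function_space_def by blast
  define R where "R = \<bar>K0\<bar> * (norm g0 + 1) + 1"
  have R1: "R \<ge> 1" by (simp add: R_def)
  have bstar_le: "\<forall>\<^sub>F n in sequentially. L2_set (bstar n) {..<q n} + 1 \<le> R"
  proof -
    have "\<forall>\<^sub>F n in sequentially. norm (gstar n - g0) < 1"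
      using A3ii(2) by (rule order_tendstoD) simp
    then show ?thesis
    proof eventually_elim
      case (elim n)
      have "L2_set (bstar n) {..<q n} = sqrt ((L2_set (bstar n) {..<q n})\<^sup>2)" by simp
      also have "(L2_set (bstar n) {..<q n})\<^sup>2 = (\<integral>p. (val (gstar n) (cov p))\<^sup>2 \<partial>P)"
        unfolding gstar_def by (rule sieve_L2_isometry[OF H P(2) cov, symmetric]) (rule A3i)
      also have "sqrt \<dots> \<le> K0 * norm (gstar n)" by (rule K0)
      also have "\<dots> \<le> \<bar>K0\<bar> * (norm g0 + 1)"
      proof (intro mult_mono)
        have "norm (gstar n) \<le> norm g0 + norm (gstar n - g0)"
          using norm_triangle_ineq[of g0 "gstar n - g0"] by simp
        with elim show "norm (gstar n) \<le> norm g0 + 1" by linarith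
      qed auto
      finally show ?case by (simp add: R_def)
    qed
  qed

  define v where "v = r * \<beta> powr r * exp (- (\<beta> powr r * R powr r))"
  have v: "v > 0" using r \<beta> by (simp add: v_def)
  \<comment> \<open>The ratio n * lam n / q n eventually exceeds A: otherwise gamma * exp (- n * lam n / q n),
    with gamma at least 1, would not be small against the bounded sequence \<delta>.\<close>
  define A where "A = 1 + ln R + \<bar>ln v\<bar>"
  have A_ge: "A \<ge> 1" using R1 by (simp add: A_def)
  obtain \<Delta> where \<Delta>: "\<Delta> > 0" "\<forall>\<^sub>F n in sequentially. \<delta> n \<le> \<Delta>"
  proof -
    from \<delta>(2) obtain c where c: "c > 0" "\<forall>\<^sub>F n in sequentially. norm (\<delta> n) \<le> c * norm (1::real)"
      by (elim landau_o.bigE)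
    show ?thesis
      by (rule that[of c]) (use c(1) eventually_mono[OF c(2), of "\<lambda>n. \<delta> n \<le> c"] in auto)
  qed

  show ?thesis
    unfolding tendsto_in_prob_def
  proof (intro allI impI)
    fix e \<eta> :: real
    assume e: "e > 0" and \<eta>: "\<eta> > 0"
    from A2[unfolded bounded_in_prob_def, rule_format, OF \<eta>] obtain K1 where
      K1: "\<forall>\<^sub>F n in sequentially. \<exists>A\<in>sets M. measure M A \<le> \<eta> \<and>
             {\<omega>\<in>space M. \<bar>SUP g\<in>sieve_box \<phi> (q n) (B n).
                  \<bar>ereal (emp_crit \<rho> (k n) n (\<lambda>i. D i \<omega>) g) - crit P m g\<bar>\<bar> > ereal (K1 * lam n)} \<subseteq> A"
      by blast
    define K where "K = max K1 0"
    have K: "K \<ge> 0" "K1 \<le> K" by (auto simp: K_def)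
    \<comment> \<open>L * n * rate n bounds the exponent lost in the normalising constant.  With the rates below
      c * B n powr r / n and c * \<delta> n, the four bounds on c make this loss at most half of the prior
      tail exponent, make it (with the error in the empirical criterion) at most n * \<delta> n / 4,
      make q n at most n * \<delta> n / 4, and force n * lam n / q n to be at least A.\<close>
    define L where "L = 2 + (1 + 2 * C + K) / 2"
    have L: "L > 0" using K A4(1) by (simp add: L_def add_pos_nonneg)
    define c where "c = Min {\<beta> powr r / (2 * L), 1 / (4 * (L + K / 2)), 1 / 4, exp (- A) / \<Delta>}"
    have LK: "L + K / 2 > 0" using L K by simp
    have "c > 0"
      using \<beta> L LK \<Delta> by (simp add: c_def)
    moreover have "c \<le> \<beta> powr r / (2 * L)" "c \<le> 1 / (4 * (L + K / 2))" "c \<le> 1 / 4" "c \<le> exp (- A) / \<Delta>"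
      by (simp_all only: c_def Min_le finite.intros insert_iff simp_thms)
    ultimately have c: "c > 0" "c \<le> \<beta> powr r / (2 * L)" "c \<le> 1 / (4 * (L + K / 2))"
      "c \<le> 1 / 4" "c \<le> exp (- A) / \<Delta>" .
    have decay: "(\<lambda>n. exp (- (\<beta> powr r * B n powr r) / 2) + exp (- real (q n))) \<longlonglongrightarrow> 0 + 0"
    proof (intro tendsto_add)
      have "filterlim (\<lambda>n. \<beta> powr r / 2 * B n powr r) at_top sequentially"
        using \<beta> by (intro filterlim_tendsto_pos_mult_at_top[OF tendsto_const]
            filterlim_compose[OF filterlim_powr_at_top[OF r] B]) auto
      then show "(\<lambda>n. exp (- (\<beta> powr r * B n powr r) / 2)) \<longlonglongrightarrow> 0"
        by (intro filterlim_compose[OF exp_at_bot]) (simp add: filterlim_uminus_at_bot)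
      show "(\<lambda>n. exp (- real (q n))) \<longlonglongrightarrow> 0"
        using filterlim_compose[OF filterlim_real_sequentially q]
        by (intro filterlim_compose[OF exp_at_bot]) (simp add: filterlim_uminus_at_bot)
    qed
    then have small: "\<forall>\<^sub>F n in sequentially.
        exp (- (\<beta> powr r * B n powr r) / 2) + exp (- real (q n)) < e"
      by (rule order_tendstoD) (use e in simp)
    have q_large: "\<forall>\<^sub>F n in sequentially. max 1 (nat \<lceil>r\<rceil>) \<le> q n"
      using q unfolding filterlim_at_top by blast
    have B_large: "\<forall>\<^sub>F n in sequentially. R \<le> B n"
      using B unfolding filterlim_at_top by blast
    show "\<forall>\<^sub>F n in sequentially. \<exists>A\<in>sets M. measure M A \<le> \<eta> \<and>
        {\<omega>\<in>space M. \<bar>quasi_posterior r \<beta> \<rho> \<phi> (q n) (k n) n (\<lambda>i. D i \<omega>)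
           {b \<in> space (coeff_space (q n)). crit P m (sieve \<phi> (q n) b) < ereal (\<delta> n)} - 1\<bar> > e} \<subseteq> A"
      using K1 small q_large B_large bstar_le \<Delta>(2) eventually_gt_at_top[of 0]
        rate_B[unfolded ereal_smallo_def, rule_format, OF c(1)]
        rate_\<delta>[unfolded ereal_smallo_def, rule_format, OF c(1)]
    proof eventually_elim
      case (elim n)
      note K1n = elim(1) and smalln = elim(2) and qn = elim(3) and Bn = elim(4)
        and bn = elim(5) and \<Delta>n = elim(6) and n = elim(7) and rB = elim(8) and r\<delta> = elim(9)
      have q1: "q n \<ge> 1" and qr: "real (q n) \<ge> r" using qn by linarith+
      have Bpos: "B n > 0" using Bn R1 by simp
      \<comment> \<open>The radius balances two effects: it makes the prior mass of the ball about exp (- n * lam n),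
        and the criterion varies on the ball by at most a multiple of gamma * \<epsilon>, a term of the rate.\<close>
      define \<epsilon> where "\<epsilon> = exp (- (real n * lam n / real (q n)))"
      have \<epsilon>: "\<epsilon> > 0" "\<epsilon> \<le> 1" using lam(1)[of n] by (auto simp: \<epsilon>_def)
      define \<gamma> where "\<gamma> = gamma_bound m \<phi> (q n) (B n)"
      have \<gamma>1: "\<gamma> \<ge> 1" unfolding \<gamma>_def using Bpos by (intro gamma_bound_ge_one) simp
      have rate_parts: "crit P m (gstar n) \<le> rate n" "ereal (lam n) \<le> rate n" "\<gamma> * ereal \<epsilon> \<le> rate n"
        by (simp_all add: rate_def \<gamma>_def \<epsilon>_def le_max_iff_disj)
      have "\<bar>rate n\<bar> \<noteq> \<infinity>" using r\<delta> by auto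
      then obtain y where y: "rate n = ereal y" by (cases "rate n") auto
      have y_lam: "lam n \<le> y" using rate_parts(2) y by simp
      have "y > 0" using y_lam lam(1)[of n] by linarith
      then have yB: "y \<le> c * (B n powr r / real n)" and y\<delta>: "y \<le> c * \<delta> n"
        using rB r\<delta> \<delta>(1)[of n] by (auto simp: y)
      have "\<gamma> \<noteq> \<infinity>" using rate_parts(3) \<epsilon> y by auto
      with \<gamma>1 obtain G where G: "\<gamma> = ereal G" "G \<ge> 1" by (cases \<gamma>) auto
      have G\<epsilon>: "G * \<epsilon> \<le> y" using rate_parts(3) G y by simp

      have box_bound: "AE p in P. \<bar>m g (snd p)\<bar> \<le> G" if "g \<in> sieve_box \<phi> (q n) (B n)" for g
      proof -
        have "gamma_bound m \<phi> (q n) (B n) \<le> ereal G" using G(1) by (simp add: \<gamma>_def)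
        from W_range residual_mean_le_gamma_bound[OF that _ this] show ?thesis
          by (rule eventually_mono)
      qed
      have in_box: "sieve \<phi> (q n) b \<in> sieve_box \<phi> (q n) (B n)"
        if "L2_set (\<lambda>i. b i - bstar n i) {..<q n} \<le> \<epsilon>" for b
      proof (rule sieve_in_box)
        have "L2_set b {..<q n} \<le> L2_set (\<lambda>i. b i - bstar n i) {..<q n} + L2_set (bstar n) {..<q n}"
          using L2_set_triangle_ineq[of "\<lambda>i. b i - bstar n i" "bstar n" "{..<q n}"] by simp
        then show "L2_set b {..<q n} \<le> B n" using that \<epsilon> bn Bn by linarith
      qed
      have near: "crit P m (sieve \<phi> (q n) b) \<le> ereal ((1 + 2 * C) * y)"
        if b: "L2_set (\<lambda>i. b i - bstar n i) {..<q n} \<le> \<epsilon>" for b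
      proof -
        let ?I = "\<integral>p. \<bar>m (sieve \<phi> (q n) b) (snd p) - m (gstar n) (snd p)\<bar> \<partial>P"
        have "crit P m (sieve \<phi> (q n) b) \<le> crit P m (gstar n) + ereal (2 * G * ?I)"
        proof (rule crit_le_of_close[OF P m_meas m_meas m_int])
          show "AE p in P. \<bar>m (sieve \<phi> (q n) b) (snd p)\<bar> \<le> G"
            by (rule box_bound[OF in_box[OF b]])
          show "AE p in P. \<bar>m (gstar n) (snd p)\<bar> \<le> G"
            unfolding gstar_def by (rule box_bound[OF in_box]) (use \<epsilon> in \<open>simp add: L2_set_def\<close>)
        qed
        also have "\<dots> \<le> ereal y + ereal (2 * C * y)"
        proof (intro add_mono)
          show "crit P m (gstar n) \<le> ereal y" using rate_parts(1) y by simp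
          have "?I \<le> C * \<epsilon>"
            unfolding gstar_def
            by (rule order_trans[OF lip mult_left_mono[OF b less_imp_le[OF A4(1)]]])
          then have "2 * G * ?I \<le> 2 * G * (C * \<epsilon>)" using G by (intro mult_left_mono) auto
          also have "\<dots> = 2 * C * (G * \<epsilon>)" by simp
          also have "\<dots> \<le> 2 * C * y" using G\<epsilon> A4(1) by (intro mult_left_mono) auto
          finally show "ereal (2 * G * ?I) \<le> ereal (2 * C * y)" by simp
        qed
        finally show ?thesis by (simp add: algebra_simps)
      qed

      have qx: "real (q n) * A \<le> real n * lam n"
      proof -
        have "\<epsilon> \<le> G * \<epsilon>" using G \<epsilon> by simp
        also have "\<dots> \<le> c * \<Delta>" using G\<epsilon> y\<delta> mult_left_mono[OF \<Delta>n, of c] c(1) by linarith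
        also have "\<dots> \<le> exp (- A)" using c(5) \<Delta>(1) by (simp add: field_simps)
        finally have "A \<le> real n * lam n / real (q n)" by (simp add: \<epsilon>_def)
        then show ?thesis using q1 by (simp add: field_simps)
      qed

      obtain E where E: "E \<in> sets M" "measure M E \<le> \<eta>"
        "{\<omega>\<in>space M. \<bar>SUP g\<in>sieve_box \<phi> (q n) (B n).
            \<bar>ereal (emp_crit \<rho> (k n) n (\<lambda>i. D i \<omega>) g) - crit P m g\<bar>\<bar> > ereal (K1 * lam n)} \<subseteq> E"
        using K1n by blast
      have "\<bar>quasi_posterior r \<beta> \<rho> \<phi> (q n) (k n) n (\<lambda>i. D i \<omega>)
           {b \<in> space (coeff_space (q n)). crit P m (sieve \<phi> (q n) b) < ereal (\<delta> n)} - 1\<bar> \<le> e"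
        if \<omega>: "\<omega> \<in> space M" "\<omega> \<notin> E" for \<omega>
      proof -
        let ?dev = "\<lambda>g. \<bar>ereal (emp_crit \<rho> (k n) n (\<lambda>i. D i \<omega>) g) - crit P m g\<bar>"
        have "\<bar>SUP g\<in>sieve_box \<phi> (q n) (B n). ?dev g\<bar> \<le> ereal (K1 * lam n)"
          using E(3) \<omega> by (auto simp: not_less)
        also have "K1 * lam n \<le> K * lam n"
          using K(2) lam(1)[of n] by (intro mult_right_mono) auto
        finally have "\<bar>SUP g\<in>sieve_box \<phi> (q n) (B n). ?dev g\<bar> \<le> ereal (K * lam n)"
          by simp
        moreover have "x \<le> \<bar>x\<bar>" for x :: ereal by (cases x) auto
        ultimately have sup: "(SUP g\<in>sieve_box \<phi> (q n) (B n). ?dev g) \<le> ereal (K * lam n)"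
          by (rule order_trans[rotated])
        have dev: "?dev g \<le> ereal (K * lam n)" if "g \<in> sieve_box \<phi> (q n) (B n)" for g
          using sup that by (auto simp: SUP_le_iff)
        have "\<bar>quasi_posterior r \<beta> \<rho> \<phi> (q n) (k n) n (\<lambda>i. D i \<omega>)
             {b \<in> space (coeff_space (q n)). crit P m (sieve \<phi> (q n) b) < ereal (\<delta> n)} - 1\<bar>
          \<le> (exp (- (\<beta> powr r * B n powr r)) + exp (- (real n / 2 * (\<delta> n - K * lam n)))) /
            (v / real (q n) * (\<epsilon> / R) ^ q n * exp (- (real n / 2 * ((1 + 2 * C) * y + K * lam n))))"
          unfolding v_def
          using q1 qr \<epsilon> bn R1 Bn
          by (intro quasi_posterior_bound[OF r \<beta> _ _ _ _ _ _ rho_sieve crit_meas dev near, where c = "bstar n"]) auto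
        also have "\<dots> = (exp (- (\<beta> powr r * B n powr r)) +
               exp (- ((real n * \<delta> n - K * (real n * lam n)) / 2))) /
            (v / real (q n) * (exp (- (real n * lam n / real (q n))) / R) ^ q n *
               exp (- ((real n * ((1 + 2 * C) * y) + K * (real n * lam n)) / 2)))"
        proof -
          have "real n / 2 * (a - K * b) = (real n * a - K * (real n * b)) / 2"
               "real n / 2 * (a + K * b) = (real n * a + K * (real n * b)) / 2" for a b
            by (simp_all add: field_simps)
          then show ?thesis unfolding \<epsilon>_def by (simp only:)
        qed
        also have "\<dots> \<le> exp (- (\<beta> powr r * B n powr r) / 2) + exp (- real (q n))"
        proof (rule posterior_odds_bound[where y = "real n * y" and c = "1 + 2 * C"])
          show "1 \<le> q n" "1 \<le> R" "0 < v" "0 \<le> K" using q1 R1 v K by auto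
          show "real n * lam n \<le> real n * y" using y_lam by (simp add: mult_left_mono)
          show "real n * ((1 + 2 * C) * y) \<le> (1 + 2 * C) * (real n * y)" by simp
          show "real (q n) * (1 + ln R + \<bar>ln v\<bar>) \<le> real n * lam n" using qx by (simp add: A_def)
          have "L * (real n * y) \<le> L * (c * B n powr r)"
            using yB n L by (intro mult_left_mono) (auto simp: field_simps)
          also have "\<dots> \<le> \<beta> powr r * B n powr r / 2"
          proof -
            have "L * c \<le> \<beta> powr r / 2" using c(2) L by (simp add: field_simps)
            from mult_right_mono[OF this, of "B n powr r"] show ?thesis by (simp add: mult_ac)
          qed
          finally show "(2 + (1 + 2 * C + K) / 2) * (real n * y) \<le> \<beta> powr r * B n powr r / 2"
            by (simp add: L_def)
          have ny: "real n * y \<le> c * (real n * \<delta> n)"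
            using mult_left_mono[OF y\<delta>, of "real n"] by (simp add: mult_ac)
          have "(L + K / 2) * (real n * y) \<le> (L + K / 2) * (c * (real n * \<delta> n))"
            using ny LK by (intro mult_left_mono) auto
          also have "\<dots> \<le> real n * \<delta> n / 4"
          proof -
            have "(L + K / 2) * c \<le> 1 / 4" using c(3) LK by (simp add: field_simps)
            from mult_right_mono[OF this, of "real n * \<delta> n"] \<delta>(1)[of n] show ?thesis
              by (simp add: mult_ac)
          qed
          finally show "(2 + (1 + 2 * C + K) / 2 + K / 2) * (real n * y) \<le> real n * \<delta> n / 4"
            by (simp add: L_def)
          have "real (q n) \<le> real (q n) * A" using mult_left_mono[OF A_ge, of "real (q n)"] by simp
          also have "\<dots> \<le> real n * y"
            using qx mult_left_mono[OF y_lam, of "real n"] by linarith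
          also have "\<dots> \<le> 1 / 4 * (real n * \<delta> n)"
            using ny mult_right_mono[OF c(4), of "real n * \<delta> n"] \<delta>(1)[of n] by simp
          finally show "real (q n) \<le> real n * \<delta> n / 4" by simp
        qed
        finally show ?thesis using smalln by simp
      qed
      then show ?case using E by (intro bexI[of _ E]) (auto simp: not_less[symmetric])
    qed
  qed
qed

end
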